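(* Let $1\leq p<\infty$ and let $g\in \mathrm{BMOA}$ be non-constant. Then $H^p$ is strictly smaller than $[T_g,H^p]$, that is, $H^p\subsetneq [T_g,H^p]$. Moreover, for every $f\in H^p$, $$\|f\|_{[T_g,H^p]}\leq C\,\|f\|_p,$$ where $C=\|T_g\|_{H^p\to H^p}$ is the operator norm of $T_g:H^p\to H^p$.
   Context: $\mathbb D$ is the open unit disk and $\mathrm{Hol}(\mathbb D)$ is the space of analytic functions on $\mathbb D$. For $1\le p<\infty$, $H^p$ is the Hardy space of $f\in\mathrm{Hol}(\mathbb D)$ with $\|f\|_p=\sup_{0\le r<1}\left(\int_0^{2\pi}|f(re^{it})|^p\frac{dt}{2\pi}\right)^{1/p}<\infty$. $\mathrm{BMOA}$ is the space of $g\in H^2$ with $\sup_{a\in\mathbb D}\|g\circ\phi_a-g(a)\|_2<\infty$, where $\phi_a(z)=\frac{a-z}{1-\overline a z}$. For $f,g\in\mathrm{Hol}(\mathbb D)$, the generalized Volterra operator is $T_g(f)(z)=\int_0^z f(\zeta)g'(\zeta)\,d\zeta$, $z\in\mathbb D$; it is known that $T_g:H^p\to H^p$ is bounded if and only if $g\in\mathrm{BMOA}$. The optimal domain is $[T_g,H^p]=\{f\in\mathrm{Hol}(\mathbb D): T_g(f)\in H^p\}$ with norm $\|f\|_{[T_g,H^p]}=\|T_g(f)\|_p$. *)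

theory Defs
  imports "HOL-Complex_Analysis.Complex_Analysis"
begin

text \<open>Functions on the open unit disk are represented by total functions on the complex plane.
  All the notions below depend only on the values of their arguments on \<^term>\<open>ball (0::complex) 1\<close>
  (for \<open>deriv\<close> this holds because the disk is open), so strict inclusions between
  the sets below are strict inclusions between the corresponding spaces of functions on the disk.\<close>

definition integral_mean :: "real \<Rightarrow> (complex \<Rightarrow> complex) \<Rightarrow> real \<Rightarrow> real" where
  "integral_mean p f r =
     (integral {0..2 * pi} (\<lambda>t. norm (f (of_real r * cis t)) powr p / (2 * pi))) powr (1 / p)"

text \<open>The supremum is taken in the extended nonnegative reals, so that it is \<^term>\<open>\<infinity>::ennreal\<close>
  for a holomorphic function outside the Hardy space.\<close>

definition hardy_norm :: "real \<Rightarrow> (complex \<Rightarrow> complex) \<Rightarrow> ennreal" where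
  "hardy_norm p f = (SUP r\<in>{0..<1}. ennreal (integral_mean p f r))"

definition hardy_space :: "real \<Rightarrow> (complex \<Rightarrow> complex) set" where
  "hardy_space p = {f. f holomorphic_on ball 0 1 \<and> hardy_norm p f < \<infinity>}"

definition disk_involution :: "complex \<Rightarrow> complex \<Rightarrow> complex" where
  "disk_involution a z = (a - z) / (1 - cnj a * z)"

definition BMOA :: "(complex \<Rightarrow> complex) set" where
  "BMOA = {g \<in> hardy_space 2.
     (SUP a\<in>ball 0 1. hardy_norm 2 (\<lambda>z. g (disk_involution a z) - g a)) < \<infinity>}"

definition volterra :: "(complex \<Rightarrow> complex) \<Rightarrow> (complex \<Rightarrow> complex) \<Rightarrow> complex \<Rightarrow> complex" where
  "volterra g f z = contour_integral (linepath 0 z) (\<lambda>\<zeta>. f \<zeta> * deriv g \<zeta>)"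

definition optimal_domain :: "real \<Rightarrow> (complex \<Rightarrow> complex) \<Rightarrow> (complex \<Rightarrow> complex) set" where
  "optimal_domain p g = {f. f holomorphic_on ball 0 1 \<and> volterra g f \<in> hardy_space p}"

definition optimal_domain_norm :: "real \<Rightarrow> (complex \<Rightarrow> complex) \<Rightarrow> (complex \<Rightarrow> complex) \<Rightarrow> ennreal" where
  "optimal_domain_norm p g f = hardy_norm p (volterra g f)"

definition hardy_operator_norm ::
    "real \<Rightarrow> ((complex \<Rightarrow> complex) \<Rightarrow> (complex \<Rightarrow> complex)) \<Rightarrow> ennreal" where
  "hardy_operator_norm p T = (SUP f\<in>{f \<in> hardy_space p. hardy_norm p f \<le> 1}. hardy_norm p (T f))"

end

(*
  Let g be in BMOA with norm at most sqrt M and let h = T_g f, so h' = f g'. If H is the Poisson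
  extension of |g|^2, then H(a) - |g(a)|^2 = ||g o phi_a - g(a)||_2^2, so psi = (|g|^2 - H) / M takes
  values in [-1, 0] and has Laplacian 4 |g'|^2 / M. Since ln |f| is subharmonic, the Laplacian of
  exp(psi) |f|^p is at least 4 exp(psi) |f|^p |g'|^2 / M. Hence suitable combinations of |f|^p,
  exp(psi) |f|^p, exp(psi) |h|^p and -|h|^p (regularised at the zeros) are subharmonic and nonnegative
  at 0, and their mean value inequality on a circle bounds the mean of |h|^p by a multiple of the mean
  of |f|^p, uniformly in the radius. This gives the boundedness of T_g on H^p for all p >= 1.

  For strictness, Parseval's identity and dominated convergence give T_g(z^n) -> 0 in H^2, and by
  interpolation with the boundedness in H^(2p) also in H^p. If the exponents n_k grow fast enough,
  f = sum (k + 1) z^(n_k) has T_g f in H^p, but its Taylor coefficients are unbounded, so f is not in H^p.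
*)
theory Submission
  imports Defs
begin

section \<open>Laplacians and the sub-mean value property\<close>

text \<open>All estimates live on disks of radius less than 1, so boundary values of
  \<open>g\<close> never enter; the constants must depend on \<open>p\<close> and \<open>M\<close>
  only, not on the radius. The mean value inequality needs just the sign of a Laplacian, which the
  coordinate \<open>w\<close> with \<open>z = exp w\<close> preserves (it contributes a factor
  |z|^2). Circles become vertical segments there, and explicit second derivatives along the two axes
  are enough, hence \<open>dir_C2\<close>. The centre \<open>z = 0\<close> is not reached by
  \<open>exp\<close> and enters by continuity.

  Two Bellman functions are needed. With \<open>q = p / 2\<close>, the Laplacian of |h|^p carries
  the factor |h|^(2q-2). For \<open>q < 1\<close> it is unbounded near zeros of \<open>h\<close>,
  which is cured by replacing |h|^2 with |h|^2 + |f|^2; for \<open>q \<ge> 1\<close> it is a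
  nonnegative power, absorbed by the weighted copy of |h|^p.

  For strictness no completeness argument is invoked: the failure of T_g to be bounded below is
  turned into an explicit function. The detour through 2p covers large \<open>p\<close>, where
  smallness in H^2 alone says nothing about H^p.\<close>

definition dir_C2 :: "complex \<Rightarrow> complex set \<Rightarrow> (complex \<Rightarrow> real) \<Rightarrow> (complex \<Rightarrow> real) \<Rightarrow> (complex \<Rightarrow> real) \<Rightarrow> bool"
  where "dir_C2 v S Y Y1 Y2 \<longleftrightarrow> continuous_on S Y \<and> continuous_on S Y1 \<and> continuous_on S Y2 \<and>
    (\<forall>w\<in>S. ((\<lambda>\<tau>. Y (w + of_real \<tau> * v)) has_real_derivative Y1 w) (at 0) \<and>
           ((\<lambda>\<tau>. Y1 (w + of_real \<tau> * v)) has_real_derivative Y2 w) (at 0))"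

text \<open>The derivative of \<open>Y\<close> at \<open>w\<close> in direction \<open>v\<close> is \<open>Re (d w * v)\<close>; that is, \<open>d\<close> is the
  conjugate of the gradient.\<close>

definition has_laplacian :: "complex set \<Rightarrow> (complex \<Rightarrow> real) \<Rightarrow> (complex \<Rightarrow> complex) \<Rightarrow> (complex \<Rightarrow> real) \<Rightarrow> bool"
  where "has_laplacian S Y d l \<longleftrightarrow> (\<exists>e1 e2. dir_C2 1 S Y (\<lambda>w. Re (d w)) e1 \<and>
    dir_C2 \<i> S Y (\<lambda>w. Re (d w * \<i>)) e2 \<and> (\<forall>w\<in>S. l w = e1 w + e2 w))"

lemma dir_C2_add:
  assumes "dir_C2 v S Y Y1 Y2" "dir_C2 v S Z Z1 Z2"
  shows "dir_C2 v S (\<lambda>w. Y w + Z w) (\<lambda>w. Y1 w + Z1 w) (\<lambda>w. Y2 w + Z2 w)"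
  using assms unfolding dir_C2_def by (auto intro!: continuous_intros derivative_intros)

lemma dir_C2_compose:
  assumes Y: "dir_C2 v S Y Y1 Y2"
    and \<phi>: "\<And>w. w \<in> S \<Longrightarrow> (\<phi> has_real_derivative \<phi>1 (Y w)) (at (Y w))"
    and \<phi>1: "\<And>w. w \<in> S \<Longrightarrow> (\<phi>1 has_real_derivative \<phi>2 (Y w)) (at (Y w))"
    and \<phi>2: "continuous_on (Y ` S) \<phi>2"
  shows "dir_C2 v S (\<lambda>w. \<phi> (Y w)) (\<lambda>w. \<phi>1 (Y w) * Y1 w) (\<lambda>w. \<phi>2 (Y w) * (Y1 w)\<^sup>2 + \<phi>1 (Y w) * Y2 w)"
proof -
  have c: "continuous_on (Y ` S) \<phi>" "continuous_on (Y ` S) \<phi>1"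
    using \<phi> \<phi>1 by (auto intro!: continuous_at_imp_continuous_on intro: DERIV_isCont)
  have cY: "continuous_on S Y" "continuous_on S Y1" "continuous_on S Y2"
    using Y by (auto simp: dir_C2_def)
  have cc: "continuous_on S (\<lambda>w. \<phi> (Y w))" "continuous_on S (\<lambda>w. \<phi>1 (Y w))" "continuous_on S (\<lambda>w. \<phi>2 (Y w))"
    using c \<phi>2 cY by (auto intro: continuous_on_compose2)
  have "((\<lambda>\<tau>. \<phi> (Y (w + of_real \<tau> * v))) has_real_derivative \<phi>1 (Y w) * Y1 w) (at 0) \<and>
     ((\<lambda>\<tau>. \<phi>1 (Y (w + of_real \<tau> * v)) * Y1 (w + of_real \<tau> * v)) has_real_derivative
        \<phi>2 (Y w) * (Y1 w)\<^sup>2 + \<phi>1 (Y w) * Y2 w) (at 0)" if w: "w \<in> S" for w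
  proof -
    have d1: "((\<lambda>\<tau>. Y (w + of_real \<tau> * v)) has_real_derivative Y1 w) (at 0)"
      and d2: "((\<lambda>\<tau>. Y1 (w + of_real \<tau> * v)) has_real_derivative Y2 w) (at 0)"
      using Y w by (auto simp: dir_C2_def)
    have e1: "((\<lambda>\<tau>. \<phi> (Y (w + of_real \<tau> * v))) has_real_derivative \<phi>1 (Y w) * Y1 w) (at 0)"
      using DERIV_chain2[OF _ d1, of \<phi>] \<phi>[OF w] by simp
    have e2: "((\<lambda>\<tau>. \<phi>1 (Y (w + of_real \<tau> * v))) has_real_derivative \<phi>2 (Y w) * Y1 w) (at 0)"
      using DERIV_chain2[OF _ d1, of \<phi>1] \<phi>1[OF w] by simp
    show ?thesis
      using e1 DERIV_mult[OF e2 d2] by (simp add: power2_eq_square algebra_simps)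
  qed
  then show ?thesis
    unfolding dir_C2_def using cc cY by (auto intro!: continuous_intros)
qed

lemma dir_C2_Re:
  assumes F: "F holomorphic_on S" and S: "open S"
  shows "dir_C2 v S (\<lambda>w. Re (F w)) (\<lambda>w. Re (deriv F w * v)) (\<lambda>w. Re (deriv (deriv F) w * v\<^sup>2))"
proof -
  have D: "((\<lambda>\<tau>. Re (G (w + of_real \<tau> * v))) has_real_derivative Re (deriv G w * v)) (at 0)"
    if G: "G holomorphic_on S" and w: "w \<in> S" for G w
  proof -
    have 1: "(G has_field_derivative deriv G w) (at (w + of_real 0 * v))"
      using holomorphic_derivI[OF G S w] by simp
    have 2: "((\<lambda>\<tau>. w + complex_of_real \<tau> * v) has_vector_derivative v) (at 0)"
      by (auto intro!: derivative_eq_intros)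
    have "((\<lambda>\<tau>. G (w + of_real \<tau> * v)) has_vector_derivative deriv G w * v) (at 0)"
      using field_vector_diff_chain_at[OF 2 1] by (simp add: o_def mult.commute)
    then show ?thesis
      using has_real_derivative_iff_has_vector_derivative bounded_linear.has_vector_derivative[OF bounded_linear_Re]
      by blast
  qed
  have F': "deriv F holomorphic_on S" "deriv (deriv F) holomorphic_on S"
    using F S by (auto intro!: holomorphic_deriv)
  have F'v: "(\<lambda>w. deriv F w * v) holomorphic_on S" using F' by (auto intro!: holomorphic_intros)
  have dd: "deriv (\<lambda>w. deriv F w * v) w = deriv (deriv F) w * v" if "w \<in> S" for w
    using F' S that by (intro DERIV_imp_deriv) (auto intro!: derivative_eq_intros holomorphic_derivI[of _ S])
  show ?thesis
    unfolding dir_C2_def using D[OF F] D[OF F'v] F F'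
    by (auto intro!: continuous_intros holomorphic_on_imp_continuous_on simp: dd power2_eq_square mult.assoc)
qed

lemma dir_C2_cong:
  assumes Y: "dir_C2 v S Y Y1 Y2" and S: "open S"
    and eq: "\<And>w. w \<in> S \<Longrightarrow> Y w = Z w" "\<And>w. w \<in> S \<Longrightarrow> Y1 w = Z1 w" "\<And>w. w \<in> S \<Longrightarrow> Y2 w = Z2 w"
  shows "dir_C2 v S Z Z1 Z2"
proof -
  have ev: "\<forall>\<^sub>F \<tau> in nhds 0. w + of_real \<tau> * v \<in> S" if "w \<in> S" for w
  proof -
    have "((\<lambda>\<tau>::real. w + of_real \<tau> * v) \<longlongrightarrow> w + of_real 0 * v) (nhds 0)"
      by (intro tendsto_intros filterlim_ident)
    then show ?thesis
      using S that by (auto dest: topological_tendstoD)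
  qed
  have "((\<lambda>\<tau>. Z (w + of_real \<tau> * v)) has_real_derivative Z1 w) (at 0) \<and>
        ((\<lambda>\<tau>. Z1 (w + of_real \<tau> * v)) has_real_derivative Z2 w) (at 0)" if w: "w \<in> S" for w
  proof -
    have "\<forall>\<^sub>F \<tau> in nhds 0. Y (w + of_real \<tau> * v) = Z (w + of_real \<tau> * v)"
      "\<forall>\<^sub>F \<tau> in nhds 0. Y1 (w + of_real \<tau> * v) = Z1 (w + of_real \<tau> * v)"
      using ev[OF w] by (eventually_elim, simp add: eq)+
    note DERIV_cong_ev[OF refl this(1) refl] DERIV_cong_ev[OF refl this(2) refl]
    moreover have "((\<lambda>\<tau>. Y (w + of_real \<tau> * v)) has_real_derivative Z1 w) (at 0)"
      "((\<lambda>\<tau>. Y1 (w + of_real \<tau> * v)) has_real_derivative Z2 w) (at 0)"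
      using Y w eq by (auto simp: dir_C2_def)
    ultimately show ?thesis by simp
  qed
  moreover have "continuous_on S Z" "continuous_on S Z1" "continuous_on S Z2"
    using Y eq continuous_on_cong[of S S Y Z] continuous_on_cong[of S S Y1 Z1] continuous_on_cong[of S S Y2 Z2]
    unfolding dir_C2_def by simp_all
  ultimately show ?thesis by (simp add: dir_C2_def)
qed

lemma has_laplacian_cong:
  assumes "has_laplacian S Y d l" "open S"
    and "\<And>w. w \<in> S \<Longrightarrow> Y w = Z w" "\<And>w. w \<in> S \<Longrightarrow> d w = d' w" "\<And>w. w \<in> S \<Longrightarrow> l w = l' w"
  shows "has_laplacian S Z d' l'"
proof -
  obtain e1 e2 where e: "dir_C2 1 S Y (\<lambda>w. Re (d w)) e1"
    "dir_C2 \<i> S Y (\<lambda>w. Re (d w * \<i>)) e2" "\<forall>w\<in>S. l w = e1 w + e2 w"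
    using assms(1) has_laplacian_def by auto
  have "dir_C2 1 S Z (\<lambda>w. Re (d' w)) e1" "dir_C2 \<i> S Z (\<lambda>w. Re (d' w * \<i>)) e2"
    by (rule dir_C2_cong[OF e(1) assms(2)] dir_C2_cong[OF e(2) assms(2)]; simp add: assms(3,4))+
  then show ?thesis
    using e(3) assms(5) by (auto simp: has_laplacian_def)
qed

lemma has_laplacian_add:
  assumes "has_laplacian S Y d l" "has_laplacian S Z d' l'"
  shows "has_laplacian S (\<lambda>w. Y w + Z w) (\<lambda>w. d w + d' w) (\<lambda>w. l w + l' w)"
proof -
  obtain e1 e2 where e: "dir_C2 1 S Y (\<lambda>w. Re (d w)) e1"
    "dir_C2 \<i> S Y (\<lambda>w. Re (d w * \<i>)) e2" "\<forall>w\<in>S. l w = e1 w + e2 w"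
    using assms(1) has_laplacian_def by auto
  obtain e1' e2' where e': "dir_C2 1 S Z (\<lambda>w. Re (d' w)) e1'"
    "dir_C2 \<i> S Z (\<lambda>w. Re (d' w * \<i>)) e2'" "\<forall>w\<in>S. l' w = e1' w + e2' w"
    using assms(2) has_laplacian_def by auto
  show ?thesis
    unfolding has_laplacian_def
    using dir_C2_add[OF e(1) e'(1)] dir_C2_add[OF e(2) e'(2)] e(3) e'(3)
    by (intro exI[of _ "\<lambda>w. e1 w + e1' w"] exI[of _ "\<lambda>w. e2 w + e2' w"])
       (auto simp: algebra_simps)
qed

text \<open>Since \<open>d\<close> is the conjugate gradient, |d|^2 is the squared length of the
  gradient, and this is the chain rule for the Laplacian. The outer function is differentiated only
  at values that \<open>Y\<close> takes, which admits \<open>ln\<close> and \<open>powr\<close> for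
  positive \<open>Y\<close>.\<close>

lemma has_laplacian_compose:
  assumes Y: "has_laplacian S Y d l"
    and \<phi>: "\<And>w. w \<in> S \<Longrightarrow> (\<phi> has_real_derivative \<phi>1 (Y w)) (at (Y w))"
    and \<phi>1: "\<And>w. w \<in> S \<Longrightarrow> (\<phi>1 has_real_derivative \<phi>2 (Y w)) (at (Y w))"
    and \<phi>2: "continuous_on (Y ` S) \<phi>2"
  shows "has_laplacian S (\<lambda>w. \<phi> (Y w)) (\<lambda>w. of_real (\<phi>1 (Y w)) * d w)
     (\<lambda>w. \<phi>2 (Y w) * (cmod (d w))\<^sup>2 + \<phi>1 (Y w) * l w)"
proof -
  obtain e1 e2 where e: "dir_C2 1 S Y (\<lambda>w. Re (d w)) e1"
    "dir_C2 \<i> S Y (\<lambda>w. Re (d w * \<i>)) e2" "\<forall>w\<in>S. l w = e1 w + e2 w"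
    using Y has_laplacian_def by auto
  have "cmod (d w)^2 = (Re (d w))^2 + (Re (d w * \<i>))^2" for w
    by (simp add: cmod_power2)
  then show ?thesis
    unfolding has_laplacian_def
    using dir_C2_compose[OF e(1) \<phi> \<phi>1 \<phi>2] dir_C2_compose[OF e(2) \<phi> \<phi>1 \<phi>2] e(3)
    by (intro exI[of _ "\<lambda>w. \<phi>2 (Y w) * (Re (d w))\<^sup>2 + \<phi>1 (Y w) * e1 w"]
              exI[of _ "\<lambda>w. \<phi>2 (Y w) * (Re (d w * \<i>))\<^sup>2 + \<phi>1 (Y w) * e2 w"])
       (auto simp: algebra_simps)
qed

lemma has_laplacian_cmult:
  assumes "has_laplacian S Y d l"
  shows "has_laplacian S (\<lambda>w. c * Y w) (\<lambda>w. of_real c * d w) (\<lambda>w. c * l w)"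
  using has_laplacian_compose[OF assms, of "\<lambda>y. c * y" "\<lambda>_. c" "\<lambda>_. 0"]
  by (auto intro!: derivative_eq_intros)

lemma has_laplacian_const: "has_laplacian S (\<lambda>w. c) (\<lambda>w. 0) (\<lambda>w. 0)"
  unfolding has_laplacian_def dir_C2_def by (intro exI[of _ "\<lambda>_. 0"]) auto

lemma has_laplacian_Re:
  assumes "F holomorphic_on S" "open S"
  shows "has_laplacian S (\<lambda>w. Re (F w)) (deriv F) (\<lambda>w. 0)"
  unfolding has_laplacian_def using dir_C2_Re[OF assms, of 1] dir_C2_Re[OF assms, of \<i>]
  by (intro exI[of _ "\<lambda>w. Re (deriv (deriv F) w)"] exI[of _ "\<lambda>w. - Re (deriv (deriv F) w)"]) auto

lemma has_laplacian_norm2: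
  assumes F: "F holomorphic_on S" and S: "open S"
  shows "has_laplacian S (\<lambda>w. (cmod (F w))\<^sup>2) (\<lambda>w. 2 * cnj (F w) * deriv F w)
    (\<lambda>w. 4 * (cmod (deriv F w))\<^sup>2)"
proof -
  have sq: "has_laplacian S (\<lambda>w. (Re (G w))\<^sup>2) (\<lambda>w. of_real (2 * Re (G w)) * deriv G w)
      (\<lambda>w. 2 * (cmod (deriv G w))\<^sup>2 + 2 * Re (G w) * 0)"
    if "G holomorphic_on S" for G
    by (rule has_laplacian_compose[OF has_laplacian_Re[OF that S]])
       (auto intro!: derivative_eq_intros continuous_intros)
  \<comment> \<open>The real part of \<open>- \<i> * F\<close> is the imaginary part of
    \<open>F\<close>, so |F|^2 is a sum of two squares of real parts.\<close>
  have iF: "(\<lambda>w. - \<i> * F w) holomorphic_on S" using F by (auto intro!: holomorphic_intros)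
  have d: "deriv (\<lambda>w. - (\<i> * F w)) w = - (\<i> * deriv F w)" if "w \<in> S" for w
    using holomorphic_derivI[OF F S that] by (intro DERIV_imp_deriv) (auto intro!: derivative_eq_intros)
  show ?thesis
    by (rule has_laplacian_cong[OF has_laplacian_add[OF sq[OF F] sq[OF iF]] S])
       (simp_all add: d norm_mult complex_eq_iff cmod_power2 algebra_simps)
qed

section \<open>Circle means as convex functions of the logarithm of the radius\<close>

lemma integral_has_real_derivative_param:
  fixes f :: "real \<Rightarrow> real \<Rightarrow> real"
  assumes d: "\<And>x t. x < \<sigma> \<Longrightarrow> ((\<lambda>x. f x t) has_real_derivative fx x t) (at x)"
    and c: "continuous_on ({..<\<sigma>} \<times> {a..b}) (\<lambda>(x, t). f x t)"
    and cx: "continuous_on ({..<\<sigma>} \<times> {a..b}) (\<lambda>(x, t). fx x t)"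
    and x: "x < \<sigma>"
  shows "((\<lambda>x. integral {a..b} (f x)) has_real_derivative integral {a..b} (fx x)) (at x)"
proof -
  have "((\<lambda>x. integral (cbox a b) (f x)) has_real_derivative integral (cbox a b) (fx x)) (at x within {..<\<sigma>})"
  proof (rule leibniz_rule_field_derivative)
    show "f x integrable_on cbox a b" if "x \<in> {..<\<sigma>}" for x
    proof -
      have "continuous_on {a..b} (\<lambda>t. (\<lambda>(x, t). f x t) (x, t))"
        by (rule continuous_on_compose2[OF c]) (use that in \<open>auto intro!: continuous_intros\<close>)
      then show ?thesis using integrable_continuous_interval by simp
    qed
    show "((\<lambda>x. f x t) has_real_derivative fx x t) (at x within {..<\<sigma>})" if "x \<in> {..<\<sigma>}" for x t
      using d[of x t] that has_field_derivative_at_within by simp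
  qed (use cx x in simp_all)
  then show ?thesis
    using x at_within_open[of x "{..<\<sigma>}"] by simp
qed

text \<open>By convexity a negative slope at one point persists to the left of it, and the function
  would grow at least linearly towards minus infinity, against the bound \<open>B\<close>.\<close>

lemma convex_bounded_at_bot_imp_mono:
  fixes m :: "real \<Rightarrow> real"
  assumes d: "\<And>x. x < \<sigma> \<Longrightarrow> (m has_real_derivative m1 x) (at x)"
    and d1: "\<And>x. x < \<sigma> \<Longrightarrow> (m1 has_real_derivative m2 x) (at x)"
    and m2: "\<And>x. x < \<sigma> \<Longrightarrow> 0 \<le> m2 x"
    and bd: "\<And>x. x \<le> x0 \<Longrightarrow> m x \<le> B"
    and xy: "x \<le> y" "y < \<sigma>"
  shows "m x \<le> m y"
proof -
  have m1: "m1 u \<le> m1 v" if "u \<le> v" "v < \<sigma>" for u v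
    using that d1 m2 by (intro DERIV_nonneg_imp_nondecreasing[of u v m1]) (auto intro: exI[of _ "m2 _"] le_less_trans)
  have nn: "0 \<le> m1 z" if z: "z < \<sigma>" for z
  proof (rule ccontr)
    assume "\<not> 0 \<le> m1 z"
    then have neg: "m1 z < 0" by simp
    \<comment> \<open>So far to the left of \<open>z\<close> that a slope of at most
      \<open>m1 z\<close> forces \<open>m u\<close> above \<open>B\<close>.\<close>
    define u where "u = min x0 z - (\<bar>B\<bar> + \<bar>m z\<bar> + 1) / (- m1 z)"
    have "0 < (\<bar>B\<bar> + \<bar>m z\<bar> + 1) / (- m1 z)" using neg by (intro divide_pos_pos) auto
    then have uz: "u < z" "u \<le> x0" by (auto simp: u_def)
    then obtain \<xi> where \<xi>: "u < \<xi>" "\<xi> < z" "m z - m u = (z - u) * m1 \<xi>"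
      using MVT2[of u z m m1] d z by (meson le_less_trans)
    have "(z - u) * m1 \<xi> \<le> (z - u) * m1 z"
      using \<xi> uz z m1[of \<xi> z] by (intro mult_left_mono) auto
    also have "\<dots> \<le> ((\<bar>B\<bar> + \<bar>m z\<bar> + 1) / (- m1 z)) * m1 z"
      using neg by (intro mult_right_mono_neg) (auto simp: u_def)
    also have "\<dots> = - (\<bar>B\<bar> + \<bar>m z\<bar> + 1)" using neg by (simp add: field_simps)
    finally have "m u > B" using \<xi>(3) by linarith
    then show False using bd[OF uz(2)] by simp
  qed
  show ?thesis
    using xy d nn by (intro DERIV_nonneg_imp_nondecreasing[of x y m]) (auto intro: exI[of _ "m1 _"] le_less_trans)
qed

text \<open>In the coordinate \<open>z = exp w\<close>, circle means are convex functions of \<open>Re w = ln r\<close>.\<close>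

lemma circle_integral_mono:
  assumes lap: "has_laplacian {w. Re w < \<sigma>} Y d l"
    and l: "\<And>w. Re w < \<sigma> \<Longrightarrow> 0 \<le> l w"
    and per: "\<And>w. Y (w + of_real (2 * pi) * \<i>) = Y w"
    and bd: "\<And>w. Re w \<le> x0 \<Longrightarrow> Y w \<le> B" and x0: "x0 < \<sigma>"
    and xy: "x \<le> y" "y < \<sigma>"
  shows "integral {0..2*pi} (\<lambda>t. Y (Complex x t)) \<le> integral {0..2*pi} (\<lambda>t. Y (Complex y t))"
proof -
  let ?S = "{w. Re w < \<sigma>}"
  obtain e1 e2 where e: "dir_C2 1 ?S Y (\<lambda>w. Re (d w)) e1"
    "dir_C2 \<i> ?S Y (\<lambda>w. Re (d w * \<i>)) e2" "\<forall>w\<in>?S. l w = e1 w + e2 w"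
    using lap has_laplacian_def by auto
  have cont: "continuous_on ({..<\<sigma>} \<times> {0..2*pi}) (\<lambda>(x, t). Z (Complex x t))"
    if "continuous_on ?S Z" for Z :: "complex \<Rightarrow> real"
    unfolding case_prod_beta
    by (rule continuous_on_compose2[OF that]) (auto intro!: continuous_intros simp: Complex_eq)
  have cont1: "continuous_on {0..2*pi} (\<lambda>t. Z (Complex x t))"
    if "continuous_on ?S Z" "x < \<sigma>" for Z :: "complex \<Rightarrow> real" and x
    by (rule continuous_on_compose2[OF that(1)]) (use that in \<open>auto intro!: continuous_intros simp: Complex_eq\<close>)
  have shift: "((\<lambda>x. Z (Complex x t)) has_real_derivative D) (at x)"
    if "((\<lambda>\<tau>. Z (Complex x t + of_real \<tau> * 1)) has_real_derivative D) (at 0)" for Z :: "complex \<Rightarrow> real" and x t D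
  proof -
    have "Complex x t + of_real \<tau> * 1 = Complex (\<tau> + x) t" for \<tau>
      by (simp add: complex_eq_iff)
    then show ?thesis using that DERIV_shift[of "\<lambda>x. Z (Complex x t)" D 0 x] by simp
  qed
  have shifti: "((\<lambda>t. Z (Complex x t)) has_real_derivative D) (at t)"
    if "((\<lambda>\<tau>. Z (Complex x t + of_real \<tau> * \<i>)) has_real_derivative D) (at 0)" for Z :: "complex \<Rightarrow> real" and x t D
  proof -
    have "Complex x t + of_real \<tau> * \<i> = Complex x (\<tau> + t)" for \<tau>
      by (simp add: complex_eq_iff)
    then show ?thesis using that DERIV_shift[of "\<lambda>t. Z (Complex x t)" D 0 t] by simp
  qed
  define m where "m = (\<lambda>x. integral {0..2*pi} (\<lambda>t. Y (Complex x t)))"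
  define m1 where "m1 = (\<lambda>x. integral {0..2*pi} (\<lambda>t. Re (d (Complex x t))))"
  define m2 where "m2 = (\<lambda>x. integral {0..2*pi} (\<lambda>t. e1 (Complex x t)))"
  have c: "continuous_on ?S Y" "continuous_on ?S (\<lambda>w. Re (d w))" "continuous_on ?S e1" "continuous_on ?S e2"
    using e by (auto simp: dir_C2_def)
  have "(m has_real_derivative m1 x) (at x)" if "x < \<sigma>" for x
    unfolding m_def m1_def
    by (rule integral_has_real_derivative_param[OF _ cont[OF c(1)] cont[OF c(2)] that])
       (rule shift, use e(1) in \<open>auto simp: dir_C2_def\<close>)
  moreover have "(m1 has_real_derivative m2 x) (at x)" if "x < \<sigma>" for x
    unfolding m1_def m2_def
    by (rule integral_has_real_derivative_param[OF _ cont[OF c(2)] cont[OF c(3)] that])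
       (rule shift[of "\<lambda>w. Re (d w)"], use e(1) in \<open>auto simp: dir_C2_def\<close>)
  moreover have "0 \<le> m2 x" if x: "x < \<sigma>" for x
  proof -
    let ?Yt = "\<lambda>t. Re (d (Complex x t) * \<i>)"
    have Dt: "((\<lambda>t. Y (Complex x t)) has_real_derivative ?Yt t) (at t)" for t
      by (rule shifti) (use x e(2) in \<open>auto simp: dir_C2_def\<close>)
    have "((\<lambda>t. Y (Complex x (t + 2*pi))) has_real_derivative ?Yt (t + 2*pi)) (at t)" for t
      using Dt[of "t + 2*pi"] by (simp only: DERIV_shift)
    moreover have "Y (Complex x (t + 2*pi)) = Y (Complex x t)" for t
      using per[of "Complex x t"] by (simp add: Complex_eq algebra_simps)
    ultimately have "((\<lambda>t. Y (Complex x t)) has_real_derivative ?Yt (t + 2*pi)) (at t)" for t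
      by simp
    \<comment> \<open>Periodicity passes to the angular derivative, so the integral of
      \<open>e2\<close> over a full turn vanishes and \<open>m2\<close> is the integral of the whole
      Laplacian \<open>l\<close>.\<close>
    then have Yt: "?Yt (t + 2*pi) = ?Yt t" for t
      using Dt by (rule DERIV_unique)
    have "((\<lambda>t. Re (d (Complex x t) * \<i>)) has_real_derivative e2 (Complex x t)) (at t)" for t
      by (rule shifti[of "\<lambda>w. Re (d w * \<i>)"]) (use x e(2) in \<open>auto simp: dir_C2_def\<close>)
    then have "(?Yt has_vector_derivative e2 (Complex x t)) (at t within {0..2*pi})" for t
      using has_vector_derivative_at_within by (simp only: has_real_derivative_iff_has_vector_derivative) blast
    then have "((\<lambda>t. e2 (Complex x t)) has_integral ?Yt (2*pi) - ?Yt 0) {0..2*pi}"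
      by (intro fundamental_theorem_of_calculus) auto
    then have e20: "((\<lambda>t. e2 (Complex x t)) has_integral 0) {0..2*pi}"
      using Yt[of 0] by simp
    have "((\<lambda>t. e1 (Complex x t)) has_integral m2 x) {0..2*pi}"
      unfolding m2_def using cont1[OF c(3) x] by (intro integrable_integral integrable_continuous_interval)
    from has_integral_add[OF this e20] 
    have "((\<lambda>t. l (Complex x t)) has_integral m2 x) {0..2*pi}"
      using e(3) x by simp
    then show ?thesis
      by (rule has_integral_nonneg) (use l x in auto)
  qed
  moreover have "m x \<le> 2 * pi * B" if x: "x \<le> x0" for x
  proof -
    have "m x \<le> integral {0..2*pi} (\<lambda>t. B)"
      unfolding m_def using x x0 bd cont1[OF c(1), of x]
      by (intro integral_le integrable_continuous_interval) auto
    then show ?thesis by simp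
  qed
  ultimately have "m x \<le> m y" using xy by (rule convex_bounded_at_bot_imp_mono)
  then show ?thesis by (simp add: m_def)
qed

text \<open>Smoothness is required of \<open>U\<close> composed with \<open>exp\<close>, hence only
  off the origin. The value at 0 is the limit of the means over shrinking circles, and these means
  increase with the radius.\<close>

lemma sub_mean_value:
  assumes R: "0 < R" and U: "continuous_on (ball 0 R) U"
    and lap: "has_laplacian {w. Re w < ln R} (\<lambda>w. U (exp w)) d l"
    and l: "\<And>w. Re w < ln R \<Longrightarrow> 0 \<le> l w"
    and r: "0 < r" "r < R"
  shows "2 * pi * U 0 \<le> integral {0..2*pi} (\<lambda>t. U (of_real r * cis t))"
proof (rule field_le_epsilon)
  fix \<eta> :: real assume \<eta>: "0 < \<eta>"
  have "isCont U 0" using U R by (simp add: continuous_on_eq_continuous_at)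
  then obtain \<delta> where \<delta>: "\<delta> > 0" "\<And>z. cmod z < \<delta> \<Longrightarrow> \<bar>U z - U 0\<bar> < \<eta> / (2 * pi)"
    using \<eta> by (auto simp: continuous_at_eps_delta dist_norm dest!: spec[of _ "\<eta> / (2 * pi)"])
  \<comment> \<open>The circle of radius \<open>exp x0\<close> lies inside the given circle and
    within \<open>\<delta>\<close> of the origin.\<close>
  define x0 where "x0 = ln (min (r/2) (\<delta>/2))"
  have x0: "exp x0 = min (r/2) (\<delta>/2)" "x0 \<le> ln r" "x0 < ln R"
    using r \<delta>(1) by (auto simp: x0_def)
  have near: "\<bar>U (exp w) - U 0\<bar> < \<eta> / (2 * pi)" if "Re w \<le> x0" for w
  proof (rule \<delta>)
    have "cmod (exp w) \<le> exp x0" using that by simp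
    then show "cmod (exp w) < \<delta>" using x0(1) \<delta>(1) by simp
  qed
  have mono: "integral {0..2*pi} (\<lambda>t. U (exp (Complex x0 t))) \<le> integral {0..2*pi} (\<lambda>t. U (exp (Complex (ln r) t)))"
  proof (rule circle_integral_mono[OF lap l])
    show "U (exp (w + of_real (2 * pi) * \<i>)) = U (exp w)" for w
      by (simp add: exp_add exp_eq_polar flip: cis_mult)
    show "U (exp w) \<le> U 0 + \<eta> / (2 * pi)" if "Re w \<le> x0" for w
      using near[OF that] by linarith
  qed (use x0 r in auto)
  have ec: "exp (Complex x t) = of_real (exp x) * cis t" for x t
    by (simp add: exp_eq_polar)
  have "2 * pi * (U 0 - \<eta> / (2 * pi)) = integral {0..2*pi} (\<lambda>t. U 0 - \<eta> / (2 * pi))" by simp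
  also have "\<dots> \<le> integral {0..2*pi} (\<lambda>t. U (exp (Complex x0 t)))"
  proof (rule integral_le)
    show "(\<lambda>t. U (exp (Complex x0 t))) integrable_on {0..2*pi}"
      unfolding ec x0(1)
      by (intro integrable_continuous_interval continuous_on_compose2[OF U])
         (use r \<delta>(1) in \<open>auto intro!: continuous_intros simp: norm_mult\<close>)
    show "U 0 - \<eta> / (2 * pi) \<le> U (exp (Complex x0 t))" for t
      using near[of "Complex x0 t"] by simp
  qed auto
  also note mono
  also have "(\<lambda>t. U (exp (Complex (ln r) t))) = (\<lambda>t. U (of_real r * cis t))"
    using r by (simp add: ec)
  finally show "2 * pi * U 0 \<le> integral {0..2*pi} (\<lambda>t. U (of_real r * cis t)) + \<eta>"
    by (simp add: algebra_simps)
qed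

section \<open>Circle means and the Poisson integral\<close>

definition circle_mean :: "real \<Rightarrow> (complex \<Rightarrow> 'a::banach) \<Rightarrow> 'a" where
  "circle_mean r u = integral {0..2*pi} (\<lambda>t. u (of_real r * cis t)) /\<^sub>R (2 * pi)"

lemma integrable_on_circle:
  fixes u :: "complex \<Rightarrow> 'a::banach"
  assumes "continuous_on (sphere 0 r) u" "0 \<le> r"
  shows "(\<lambda>t. u (of_real r * cis t)) integrable_on {a..b}"
  by (intro integrable_continuous_interval continuous_on_compose2[OF assms(1)])
     (use assms(2) in \<open>auto intro!: continuous_intros simp: norm_mult\<close>)

lemma circle_mean_cong:
  assumes "\<And>\<zeta>. cmod \<zeta> = r \<Longrightarrow> u \<zeta> = v \<zeta>" "0 \<le> r"
  shows "circle_mean r u = circle_mean r v"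
  unfolding circle_mean_def using assms by (auto simp: norm_mult intro!: integral_cong)

lemma circle_mean_add:
  assumes "continuous_on (sphere 0 r) u" "continuous_on (sphere 0 r) v" "0 \<le> r"
  shows "circle_mean r (\<lambda>\<zeta>. u \<zeta> + v \<zeta>) = circle_mean r u + circle_mean r v"
  unfolding circle_mean_def
  by (subst integral_add) (use assms in \<open>auto intro: integrable_on_circle simp: scaleR_right_distrib\<close>)

lemma circle_mean_linear:
  assumes "bounded_linear L" "continuous_on (sphere 0 r) u" "0 \<le> r"
  shows "circle_mean r (\<lambda>\<zeta>. L (u \<zeta>)) = L (circle_mean r u)"
  using integral_linear[OF integrable_on_circle[OF assms(2,3)] assms(1), of 0 "2*pi"]
  by (simp add: circle_mean_def o_def linear_scale bounded_linear.linear[OF assms(1)])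

lemma circle_mean_const [simp]: "circle_mean r (\<lambda>_. c) = c"
  by (simp add: circle_mean_def)

lemma circle_mean_cmult [simp]:
  fixes c :: real
  shows "circle_mean r (\<lambda>\<zeta>. c * u \<zeta>) = c * circle_mean r u"
  by (simp add: circle_mean_def)

lemma circle_mean_mono:
  fixes u v :: "complex \<Rightarrow> real"
  assumes "continuous_on (sphere 0 r) u" "continuous_on (sphere 0 r) v" "0 \<le> r"
    and "\<And>\<zeta>. cmod \<zeta> = r \<Longrightarrow> u \<zeta> \<le> v \<zeta>"
  shows "circle_mean r u \<le> circle_mean r v"
  unfolding circle_mean_def
  using integral_le[OF integrable_on_circle[OF assms(1,3)] integrable_on_circle[OF assms(2,3)], of 0 "2*pi"] assms
  by (simp add: norm_mult)

lemma circle_mean_Cauchy: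
  assumes F: "continuous_on (cball 0 r) F" "F holomorphic_on ball 0 r" and z: "cmod z < r"
  shows "circle_mean r (\<lambda>\<zeta>. F \<zeta> * \<zeta> / (\<zeta> - z)) = F z"
proof -
  have "contour_integral (circlepath 0 r) (\<lambda>u. F u / (u - z)) = 2 * of_real pi * \<i> * F z"
    using Cauchy_integral_circlepath[OF F] z by (simp add: contour_integral_unique)
  also have "contour_integral (circlepath 0 r) (\<lambda>u. F u / (u - z)) =
      integral {0..2*pi} (\<lambda>t. \<i> * (F (of_real r * cis t) * (of_real r * cis t) / (of_real r * cis t - z)))"
    unfolding circlepath_def by (subst contour_integral_part_circlepath_eq) (auto simp: algebra_simps)
  also have "\<dots> = \<i> * integral {0..2*pi} (\<lambda>t. F (of_real r * cis t) * (of_real r * cis t) / (of_real r * cis t - z))"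
    by (rule integral_mult_right)
  finally show ?thesis by (simp add: circle_mean_def scaleR_conv_of_real field_simps)
qed

section \<open>Poisson kernel and harmonic extension\<close>

definition poisson_kernel :: "complex \<Rightarrow> complex \<Rightarrow> real" where
  "poisson_kernel z \<zeta> = ((cmod \<zeta>)\<^sup>2 - (cmod z)\<^sup>2) / (cmod (\<zeta> - z))\<^sup>2"

lemma Re_herglotz_kernel: "\<zeta> \<noteq> z \<Longrightarrow> Re ((\<zeta> + z) / (\<zeta> - z)) = poisson_kernel z \<zeta>"
  unfolding poisson_kernel_def Re_divide cmod_power2 by (simp add: power2_eq_square algebra_simps)

lemma continuous_on_poisson_kernel:
  "cmod z < r \<Longrightarrow> continuous_on (sphere 0 r) (poisson_kernel z)"
  unfolding poisson_kernel_def [abs_def] by (auto intro!: continuous_intros)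

text \<open>Cauchy's formula is applied to \<open>F\<close> times a holomorphic factor that equals 1
  at \<open>z\<close>. On the circle, r^2 = \<zeta> * cnj \<zeta> turns the Cauchy kernel times this
  factor into the Poisson kernel.\<close>

lemma poisson_reproduces:
  assumes F: "continuous_on (cball 0 r) F" "F holomorphic_on ball 0 r" and z: "cmod z < r"
  shows "circle_mean r (\<lambda>\<zeta>. Re (F \<zeta>) * poisson_kernel z \<zeta>) = Re (F z)"
proof -
  have r: "0 < r" using z norm_ge_zero[of z] by linarith
  define G where "G = (\<lambda>\<zeta>. F \<zeta> * of_real (r\<^sup>2 - (cmod z)\<^sup>2) / (of_real (r\<^sup>2) - cnj z * \<zeta>))"
  have nz: "of_real (r\<^sup>2) - cnj z * \<zeta> \<noteq> 0" if "cmod \<zeta> \<le> r" for \<zeta>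
  proof
    assume "of_real (r\<^sup>2) - cnj z * \<zeta> = 0"
    then have "cmod (of_real (r\<^sup>2)) = cmod (cnj z * \<zeta>)" by simp
    then have "r * r = cmod z * cmod \<zeta>" by (simp add: norm_mult power2_eq_square)
    also have "\<dots> \<le> cmod z * r" using that by (intro mult_left_mono) auto
    also have "\<dots> < r * r" using z r by simp
    finally show False by simp
  qed
  have G: "continuous_on (cball 0 r) G" "G holomorphic_on ball 0 r"
    unfolding G_def using nz F by (auto intro!: continuous_intros holomorphic_intros)
  have zz: "of_real (r\<^sup>2) - cnj z * z = of_real (r\<^sup>2 - (cmod z)\<^sup>2)"
    unfolding of_real_diff complex_norm_square by (simp add: mult.commute)
  have Gz: "G z = F z"
    using nz[of z] z unfolding G_def zz by simp
  have eq: "G \<zeta> * \<zeta> / (\<zeta> - z) = F \<zeta> * of_real (poisson_kernel z \<zeta>)" if \<zeta>: "cmod \<zeta> = r" for \<zeta>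
  proof -
    have n2: "of_real (r\<^sup>2) = \<zeta> * cnj \<zeta>" using \<zeta> complex_norm_square by metis
    have \<zeta>0: "\<zeta> \<noteq> 0" "\<zeta> \<noteq> z" using \<zeta> r z by auto
    have "of_real (r\<^sup>2) - cnj z * \<zeta> = \<zeta> * cnj (\<zeta> - z)" unfolding n2 by (simp add: algebra_simps)
    then have "G \<zeta> * \<zeta> / (\<zeta> - z) = F \<zeta> * of_real (r\<^sup>2 - (cmod z)\<^sup>2) / ((\<zeta> - z) * cnj (\<zeta> - z))"
      unfolding G_def using \<zeta>0(1) by (simp add: divide_divide_eq_left mult.assoc mult.left_commute[of \<zeta>] mult.commute[of _ \<zeta>] del: complex_cnj_diff)
    also have "\<dots> = F \<zeta> * of_real (poisson_kernel z \<zeta>)"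
      unfolding poisson_kernel_def complex_norm_square[symmetric] using \<zeta> by simp
    finally show ?thesis .
  qed
  have "circle_mean r (\<lambda>\<zeta>. F \<zeta> * of_real (poisson_kernel z \<zeta>)) = F z"
    using circle_mean_Cauchy[OF G z] Gz circle_mean_cong[OF eq, of r] r by simp
  then have "Re (circle_mean r (\<lambda>\<zeta>. F \<zeta> * of_real (poisson_kernel z \<zeta>))) = Re (F z)" by simp
  moreover have "circle_mean r (\<lambda>\<zeta>. Re (F \<zeta> * of_real (poisson_kernel z \<zeta>))) =
     Re (circle_mean r (\<lambda>\<zeta>. F \<zeta> * of_real (poisson_kernel z \<zeta>)))"
    by (rule circle_mean_linear[OF bounded_linear_Re])
       (use r F(1) z in \<open>auto intro!: continuous_intros continuous_on_poisson_kernel intro: continuous_on_subset\<close>)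
  ultimately show ?thesis by simp
qed

text \<open>Its real part is the Poisson integral of \<open>u\<close>. Keeping the holomorphic
  function itself makes harmonicity an instance of \<open>has_laplacian_Re\<close>, and compositions
  with disk involutions stay within holomorphic functions.\<close>

definition herglotz :: "real \<Rightarrow> (complex \<Rightarrow> real) \<Rightarrow> complex \<Rightarrow> complex" where
  "herglotz r u z = circle_mean r (\<lambda>\<zeta>. of_real (u \<zeta>) * ((\<zeta> + z) / (\<zeta> - z)))"

lemma herglotz_holomorphic:
  assumes u: "continuous_on (sphere 0 r) u" and r: "0 < r"
  shows "herglotz r u holomorphic_on ball 0 r"
proof -
  let ?c = "\<lambda>t. of_real r * cis t"
  have uc: "continuous_on (ball 0 r \<times> {0..2*pi}) (\<lambda>x. u (?c (snd x)))"
    by (rule continuous_on_compose2[OF u]) (use r in \<open>auto intro!: continuous_intros simp: norm_mult\<close>)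
  have nz: "?c t \<noteq> z" if "cmod z < r" for z :: complex and t
    using that r by (auto simp: norm_mult)
  have "(\<lambda>z. integral (cbox 0 (2*pi)) (\<lambda>t. of_real (u (?c t)) * ((?c t + z) / (?c t - z)))) holomorphic_on ball 0 r"
  proof (rule leibniz_rule_holomorphic)
    fix z :: complex and t :: real assume "z \<in> ball 0 r"
    then have "?c t - z \<noteq> 0" using nz[of z t] by simp
    then show "((\<lambda>z. of_real (u (?c t)) * ((?c t + z) / (?c t - z))) has_field_derivative
         of_real (u (?c t)) * (2 * ?c t / (?c t - z)\<^sup>2)) (at z within ball 0 r)"
      by (auto intro!: derivative_eq_intros simp: power2_eq_square field_simps)
  next
    fix z :: complex assume "z \<in> ball 0 r"
    then show "(\<lambda>t. of_real (u (?c t)) * ((?c t + z) / (?c t - z))) integrable_on cbox 0 (2*pi)"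
      unfolding cbox_interval using r nz
      by (intro integrable_on_circle[of r "\<lambda>\<zeta>. of_real (u \<zeta>) * ((\<zeta> + z) / (\<zeta> - z))"])
         (auto intro!: continuous_intros u)
  next
    show "continuous_on (ball 0 r \<times> cbox 0 (2 * pi))
       (\<lambda>(z, t). of_real (u (?c t)) * (2 * ?c t / (?c t - z)\<^sup>2))"
      unfolding case_prod_beta using nz uc by (auto intro!: continuous_intros)
  qed auto
  then show ?thesis
    unfolding herglotz_def[abs_def] circle_mean_def
    by (auto intro!: holomorphic_intros simp: scaleR_conv_of_real)
qed

lemma Re_herglotz:
  assumes u: "continuous_on (sphere 0 r) u" and z: "cmod z < r"
  shows "Re (herglotz r u z) = circle_mean r (\<lambda>\<zeta>. u \<zeta> * poisson_kernel z \<zeta>)"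
proof -
  have r: "0 < r" using z norm_ge_zero[of z] by linarith
  have "Re (herglotz r u z) = circle_mean r (\<lambda>\<zeta>. Re (of_real (u \<zeta>) * ((\<zeta> + z) / (\<zeta> - z))))"
    unfolding herglotz_def
    by (rule circle_mean_linear[OF bounded_linear_Re, symmetric])
       (use r u z in \<open>auto intro!: continuous_intros\<close>)
  also have "\<dots> = circle_mean r (\<lambda>\<zeta>. u \<zeta> * poisson_kernel z \<zeta>)"
  proof (rule circle_mean_cong)
    fix \<zeta> assume "cmod \<zeta> = r"
    then show "Re (of_real (u \<zeta>) * ((\<zeta> + z) / (\<zeta> - z))) = u \<zeta> * poisson_kernel z \<zeta>"
      using z Re_herglotz_kernel[of \<zeta> z] Re_complex_of_real Im_complex_of_real
      by (metis diff_zero less_irrefl mult_zero_left times_complex.simps(1))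
  qed (use r in auto)
  finally show ?thesis .
qed

lemma Re_herglotz_mono:
  assumes u: "continuous_on (sphere 0 r) u" and v: "continuous_on (sphere 0 r) v" and z: "cmod z < r"
    and le: "\<And>\<zeta>. cmod \<zeta> = r \<Longrightarrow> u \<zeta> \<le> v \<zeta>"
  shows "Re (herglotz r u z) \<le> Re (herglotz r v z)"
proof -
  have r: "0 < r" using z norm_ge_zero[of z] by linarith
  have "0 \<le> poisson_kernel z \<zeta>" if "cmod \<zeta> = r" for \<zeta>
    unfolding poisson_kernel_def using that z by (auto intro!: divide_nonneg_nonneg power_mono)
  then show ?thesis
    unfolding Re_herglotz[OF u z] Re_herglotz[OF v z]
    by (intro circle_mean_mono) (use le r u v z in \<open>auto intro!: continuous_intros continuous_on_poisson_kernel mult_right_mono\<close>)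
qed

lemma Re_herglotz_Re:
  assumes F: "continuous_on (cball 0 r) F" "F holomorphic_on ball 0 r" and z: "cmod z < r"
  shows "Re (herglotz r (\<lambda>\<zeta>. Re (F \<zeta>)) z) = Re (F z)"
  using poisson_reproduces[OF F z] F(1) z
  by (subst Re_herglotz) (auto intro!: continuous_intros intro: continuous_on_subset)

lemma Re_herglotz_0:
  assumes "continuous_on (sphere 0 r) u" "0 < r"
  shows "Re (herglotz r u 0) = circle_mean r u"
  using assms by (subst Re_herglotz) (auto simp: poisson_kernel_def intro!: circle_mean_cong)

text \<open>\<open>Re L\<close> is the tangent plane of the convex function |.|^2 at the value
  \<open>F z\<close>, evaluated along \<open>F\<close>: it stays below |F|^2, touches it at
  \<open>z\<close>, and is reproduced by the Poisson integral because \<open>L\<close> is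
  holomorphic.\<close>

lemma norm2_le_Re_herglotz:
  assumes F: "continuous_on (cball 0 r) F" "F holomorphic_on ball 0 r" and z: "cmod z < r"
  shows "(cmod (F z))\<^sup>2 \<le> Re (herglotz r (\<lambda>\<zeta>. (cmod (F \<zeta>))\<^sup>2) z)"
proof -
  define L where "L = (\<lambda>\<zeta>. 2 * cnj (F z) * F \<zeta> - of_real ((cmod (F z))\<^sup>2))"
  have L: "continuous_on (cball 0 r) L" "L holomorphic_on ball 0 r"
    unfolding L_def using F by (auto intro!: continuous_intros holomorphic_intros)
  have "Re (L z) = (cmod (F z))\<^sup>2"
    unfolding L_def cmod_power2 by (simp add: power2_eq_square)
  then have "(cmod (F z))\<^sup>2 = Re (herglotz r (\<lambda>\<zeta>. Re (L \<zeta>)) z)"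
    using Re_herglotz_Re[OF L z] by simp
  also have "\<dots> \<le> Re (herglotz r (\<lambda>\<zeta>. (cmod (F \<zeta>))\<^sup>2) z)"
  proof (rule Re_herglotz_mono[OF _ _ z])
    fix \<zeta>
    have "0 \<le> (cmod (F \<zeta> - F z))\<^sup>2" by simp
    also have "\<dots> = (cmod (F \<zeta>))\<^sup>2 - Re (L \<zeta>)"
      unfolding L_def cmod_power2 by (simp add: power2_eq_square algebra_simps)
    finally show "Re (L \<zeta>) \<le> (cmod (F \<zeta>))\<^sup>2" by simp
  qed (use F L in \<open>auto intro!: continuous_intros intro: continuous_on_subset\<close>)
  finally show ?thesis .
qed

lemma circle_mean_holomorphic:
  assumes F: "continuous_on (cball 0 r) F" "F holomorphic_on ball 0 r" and r: "0 < r"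
  shows "circle_mean r F = F 0"
  using circle_mean_Cauchy[OF F, of 0] r circle_mean_cong[of r F "\<lambda>\<zeta>. F \<zeta> * \<zeta> / (\<zeta> - 0)"] by force

text \<open>The functions |F - F 0|^2 and |F|^2 differ by the real part of a holomorphic function,
  whose mean is its value at the centre.\<close>

lemma circle_mean_norm2_diff:
  assumes F: "continuous_on (cball 0 r) F" "F holomorphic_on ball 0 r" and r: "0 < r"
  shows "circle_mean r (\<lambda>\<zeta>. (cmod (F \<zeta> - F 0))\<^sup>2) = circle_mean r (\<lambda>\<zeta>. (cmod (F \<zeta>))\<^sup>2) - (cmod (F 0))\<^sup>2"
proof -
  define L where "L = (\<lambda>\<zeta>. of_real ((cmod (F 0))\<^sup>2) - 2 * cnj (F 0) * F \<zeta>)"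
  have L: "continuous_on (cball 0 r) L" "L holomorphic_on ball 0 r"
    unfolding L_def using F by (auto intro!: continuous_intros holomorphic_intros)
  have cs: "continuous_on (sphere 0 r) F" "continuous_on (sphere 0 r) L"
    using F L by (auto intro: continuous_on_subset)
  have "circle_mean r (\<lambda>\<zeta>. (cmod (F \<zeta> - F 0))\<^sup>2) = circle_mean r (\<lambda>\<zeta>. (cmod (F \<zeta>))\<^sup>2 + Re (L \<zeta>))"
    by (rule arg_cong[where f = "circle_mean r"])
       (unfold L_def cmod_power2, simp add: fun_eq_iff power2_eq_square algebra_simps)
  also have "\<dots> = circle_mean r (\<lambda>\<zeta>. (cmod (F \<zeta>))\<^sup>2) + Re (circle_mean r L)"
    using circle_mean_linear[OF bounded_linear_Re cs(2)] r cs
    by (subst circle_mean_add) (auto intro!: continuous_intros)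
  also have "circle_mean r L = L 0" by (rule circle_mean_holomorphic[OF L r])
  also have "Re (L 0) = - (cmod (F 0))\<^sup>2"
    unfolding L_def cmod_power2 by (simp add: power2_eq_square)
  finally show ?thesis by simp
qed

section \<open>Harmonic majorants of BMOA functions\<close>

lemma norm_disk_involution_lt_1:
  assumes "cmod a < 1" "cmod z < 1"
  shows "cmod (disk_involution a z) < 1"
  using Moebius_function_norm_lt_1[OF assms, of 0]
  by (simp add: disk_involution_def Moebius_function_simple norm_divide norm_minus_commute)

lemma disk_involution_nz: "cmod a < 1 \<Longrightarrow> cmod z < 1 \<Longrightarrow> 1 - cnj a * z \<noteq> 0"
proof
  assume "cmod a < 1" "cmod z < 1" "1 - cnj a * z = 0"
  then have "cmod a * cmod z = 1" by (metis complex_mod_cnj eq_iff_diff_eq_0 norm_mult norm_one)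
  moreover have "cmod a * cmod z < 1 * 1"
    using \<open>cmod a < 1\<close> \<open>cmod z < 1\<close> by (intro mult_strict_mono') auto
  ultimately show False by simp
qed

lemma disk_involution_involution:
  assumes "cmod a < 1" "cmod z < 1"
  shows "disk_involution a (disk_involution a z) = z"
proof -
  have nz: "1 - cnj a * z \<noteq> 0" "1 - cnj a * a \<noteq> 0" using assms disk_involution_nz by auto
  have 1: "1 - cnj a * ((a - z) / (1 - cnj a * z)) = (1 - cnj a * a) / (1 - cnj a * z)"
    using nz by (simp add: field_simps)
  have 2: "a - (a - z) / (1 - cnj a * z) = z * (1 - cnj a * a) / (1 - cnj a * z)"
    using nz by (simp add: field_simps)
  show ?thesis
    unfolding disk_involution_def 1 2 using nz by simp
qed

lemma disk_involution_holomorphic: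
  "cmod a < 1 \<Longrightarrow> disk_involution a holomorphic_on ball 0 1"
  unfolding disk_involution_def[abs_def] using disk_involution_nz by (auto intro!: holomorphic_intros)

lemma holomorphic_disk_involution_compose:
  assumes "g holomorphic_on ball 0 1" "cmod a < 1"
  shows "(\<lambda>z. g (disk_involution a z)) holomorphic_on ball 0 1"
proof -
  have "disk_involution a ` ball 0 1 \<subseteq> ball 0 1"
    using norm_disk_involution_lt_1[OF assms(2)] by auto
  then show ?thesis
    using holomorphic_on_compose_gen[OF disk_involution_holomorphic[OF assms(2)] assms(1)] by (simp add: o_def)
qed

text \<open>Compare the Poisson extension on the disk of radius \<open>s\<close> with that of \<open>g \<circ> \<phi>\<^sub>a\<close> on a disk
  so large that its image under \<open>\<phi>\<^sub>a\<close> contains the former.\<close>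

lemma bmoa_harmonic_majorant:
  assumes g: "g holomorphic_on ball 0 1"
    and M: "\<And>a r. cmod a < 1 \<Longrightarrow> 0 < r \<Longrightarrow> r < 1 \<Longrightarrow>
      circle_mean r (\<lambda>z. (cmod (g (disk_involution a z) - g a))\<^sup>2) \<le> M"
    and s: "0 < s" "s < 1"
  obtains K where "K holomorphic_on ball 0 s"
    "\<And>z. cmod z < s \<Longrightarrow> (cmod (g z))\<^sup>2 \<le> Re (K z)"
    "\<And>z. cmod z < s \<Longrightarrow> Re (K z) \<le> (cmod (g z))\<^sup>2 + M"
proof -
  have g2c: "continuous_on (sphere 0 r) (\<lambda>\<zeta>. (cmod (h \<zeta>))\<^sup>2)"
    if "h holomorphic_on ball 0 1" "r < 1" for h :: "complex \<Rightarrow> complex" and r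
    using holomorphic_on_imp_continuous_on[OF that(1)] that(2)
    by (intro continuous_intros) (auto elim!: continuous_on_subset)
  have sub: "continuous_on (cball 0 r) h" "h holomorphic_on ball 0 r"
    if "h holomorphic_on ball 0 1" "r < 1" for h :: "complex \<Rightarrow> complex" and r
    using holomorphic_on_imp_continuous_on[OF that(1)] that
    by (auto elim!: continuous_on_subset holomorphic_on_subset)
  let ?K = "herglotz s (\<lambda>\<zeta>. (cmod (g \<zeta>))\<^sup>2)"
  show thesis
  proof (rule that[of ?K])
    show "?K holomorphic_on ball 0 s"
      using g2c[OF g s(2)] s by (intro herglotz_holomorphic) auto
    show "(cmod (g z))\<^sup>2 \<le> Re (?K z)" if "cmod z < s" for z
      using norm2_le_Re_herglotz[OF sub[OF g s(2)] that] .
    show "Re (?K a) \<le> (cmod (g a))\<^sup>2 + M" if a: "cmod a < s" for a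
    proof -
      let ?\<phi> = "disk_involution a"
      have a1: "cmod a < 1" using a s by simp
      note \<phi>h = disk_involution_holomorphic[OF a1]
      note \<phi>1 = norm_disk_involution_lt_1[OF a1]
      note kh = holomorphic_disk_involution_compose[OF g a1]
      have "\<exists>x\<in>cball 0 s. \<forall>y\<in>cball 0 s. cmod (?\<phi> y) \<le> cmod (?\<phi> x)"
        using s holomorphic_on_imp_continuous_on[OF \<phi>h]
        by (intro continuous_attains_sup continuous_intros) (auto elim!: continuous_on_subset)
      then obtain x where x: "x \<in> cball 0 s" "\<And>y. y \<in> cball 0 s \<Longrightarrow> cmod (?\<phi> y) \<le> cmod (?\<phi> x)"
        by blast
      have "cmod (?\<phi> x) < 1" using x s by (intro \<phi>1) auto
      then obtain \<rho> where \<rho>: "cmod (?\<phi> x) < \<rho>" "\<rho> < 1" using dense by blast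
      have \<rho>0: "0 < \<rho>" using \<rho>(1) norm_ge_zero[of "?\<phi> x"] by linarith
      have \<phi>\<rho>: "cmod (?\<phi> y) < \<rho>" if "y \<in> cball 0 s" for y using x(2)[OF that] \<rho> by simp
      let ?W = "herglotz \<rho> (\<lambda>\<zeta>. (cmod (g (?\<phi> \<zeta>)))\<^sup>2)"
      have Wh: "?W holomorphic_on ball 0 \<rho>"
        using g2c[OF kh \<rho>(2)] \<rho>0 by (intro herglotz_holomorphic) auto
      have \<phi>s: "continuous_on (cball 0 s) ?\<phi>" "?\<phi> holomorphic_on ball 0 s"
        using sub[OF \<phi>h s(2)] by auto
      have W\<phi>: "continuous_on (cball 0 s) (\<lambda>z. ?W (?\<phi> z))" "(\<lambda>z. ?W (?\<phi> z)) holomorphic_on ball 0 s"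
        using continuous_on_compose2[OF holomorphic_on_imp_continuous_on[OF Wh] \<phi>s(1)]
          holomorphic_on_compose_gen[OF \<phi>s(2) Wh] \<phi>\<rho> by (force simp: o_def)+
      \<comment> \<open>The function |g o phi_a|^2 lies below its Poisson extension
        \<open>Re ?W\<close>. Composing with the involution once more gives a harmonic function that
        lies above |g|^2 on the circle of radius \<open>s\<close>. At \<open>a\<close> it takes the
        central value of \<open>Re ?W\<close>, a circle mean that \<open>M\<close> controls.\<close>
      have "Re (?K a) \<le> Re (herglotz s (\<lambda>\<zeta>. Re (?W (?\<phi> \<zeta>))) a)"
      proof (rule Re_herglotz_mono[OF _ _ a])
        fix \<zeta> assume \<zeta>: "cmod \<zeta> = s"
        have "(cmod (g (?\<phi> (?\<phi> \<zeta>))))\<^sup>2 \<le> Re (?W (?\<phi> \<zeta>))"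
          using \<phi>\<rho>[of \<zeta>] \<zeta> by (intro norm2_le_Re_herglotz[OF sub[OF kh \<rho>(2)]]) auto
        then show "(cmod (g \<zeta>))\<^sup>2 \<le> Re (?W (?\<phi> \<zeta>))"
          using disk_involution_involution[OF a1, of \<zeta>] \<zeta> s by simp
      qed (use g2c[OF g s(2)] W\<phi> in \<open>auto intro!: continuous_intros elim: continuous_on_subset\<close>)
      also have "\<dots> = Re (?W (?\<phi> a))" by (rule Re_herglotz_Re[OF W\<phi> a])
      also have "?\<phi> a = 0" by (simp add: disk_involution_def)
      also have "Re (?W 0) = circle_mean \<rho> (\<lambda>\<zeta>. (cmod (g (?\<phi> \<zeta>)))\<^sup>2)"
        by (rule Re_herglotz_0[OF g2c[OF kh \<rho>(2)] \<rho>0])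
      also have "\<dots> = circle_mean \<rho> (\<lambda>\<zeta>. (cmod (g (?\<phi> \<zeta>) - g (?\<phi> 0)))\<^sup>2) + (cmod (g (?\<phi> 0)))\<^sup>2"
        using circle_mean_norm2_diff[OF sub[OF kh \<rho>(2)] \<rho>0] by simp
      also have "?\<phi> 0 = a" by (simp add: disk_involution_def)
      finally show ?thesis using M[OF a1 \<rho>0 \<rho>(2)] by simp
    qed
  qed
qed

section \<open>The Bellman functions\<close>

lemma has_laplacian_powr:
  assumes Y: "has_laplacian S Y d l" and pos: "\<And>w. w \<in> S \<Longrightarrow> 0 < Y w"
  shows "has_laplacian S (\<lambda>w. Y w powr q) (\<lambda>w. of_real (q * Y w powr (q - 1)) * d w)
    (\<lambda>w. q * (q - 1) * Y w powr (q - 2) * (cmod (d w))\<^sup>2 + q * Y w powr (q - 1) * l w)"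
proof (rule has_laplacian_compose[OF Y])
  fix w assume w: "w \<in> S"
  show "((\<lambda>y. y powr q) has_real_derivative q * Y w powr (q - 1)) (at (Y w))"
    by (rule has_real_derivative_powr[OF pos[OF w]])
  show "((\<lambda>y. q * y powr (q - 1)) has_real_derivative q * (q - 1) * Y w powr (q - 2)) (at (Y w))"
    using DERIV_cmult[OF has_real_derivative_powr[OF pos[OF w]], of q "q - 1"]
    by (simp add: mult.assoc algebra_simps)
next
  show "continuous_on (Y ` S) (\<lambda>y. q * (q - 1) * y powr (q - 2))"
    using pos by (intro continuous_intros) (auto simp: less_imp_neq[symmetric])
qed

text \<open>The hypothesis \<open>\<bar>d\<bar>\<^sup>2 \<le> l Y\<close> says that \<open>ln Y\<close> is subharmonic.\<close>

lemma has_laplacian_exp_times_powr: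
  assumes Y: "has_laplacian S Y d l" and pos: "\<And>w. w \<in> S \<Longrightarrow> 0 < Y w"
    and ls: "\<And>w. w \<in> S \<Longrightarrow> (cmod (d w))\<^sup>2 \<le> l w * Y w" and q: "0 \<le> q" and S: "open S"
    and \<psi>: "has_laplacian S \<psi> e k"
  obtains D L where "has_laplacian S (\<lambda>w. exp (\<psi> w) * Y w powr q) D L"
    "\<And>w. w \<in> S \<Longrightarrow> exp (\<psi> w) * Y w powr q * k w \<le> L w"
proof -
  have "has_laplacian S (\<lambda>w. ln (Y w)) (\<lambda>w. of_real (1 / Y w) * d w)
      (\<lambda>w. - 1 / (Y w)\<^sup>2 * (cmod (d w))\<^sup>2 + 1 / Y w * l w)"
  proof (rule has_laplacian_compose[OF Y])
    fix w assume w: "w \<in> S"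
    show "(ln has_real_derivative 1 / Y w) (at (Y w))"
      using pos[OF w] by (auto intro!: derivative_eq_intros)
    show "((\<lambda>y. 1 / y) has_real_derivative - 1 / (Y w)\<^sup>2) (at (Y w))"
      using pos[OF w] by (auto intro!: derivative_eq_intros simp: power2_eq_square)
  next
    show "continuous_on (Y ` S) (\<lambda>y. - 1 / y\<^sup>2)"
      using pos by (intro continuous_intros) (auto simp: less_imp_neq[symmetric])
  qed
  note E = has_laplacian_add[OF \<psi> has_laplacian_cmult[OF this, of q]]
  \<comment> \<open>The product is the exponential of \<open>E0\<close>, so its Laplacian is exp E0
    times the squared gradient plus the Laplacian of \<open>E0\<close>. Log-subharmonicity makes the
    latter at least \<open>k\<close>.\<close>
  define E0 where "E0 = (\<lambda>w. \<psi> w + q * ln (Y w))"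
  obtain d' l' where E: "has_laplacian S E0 d' l'"
    and l': "\<And>w. l' w = k w + q * (- 1 / (Y w)\<^sup>2 * (cmod (d w))\<^sup>2 + 1 / Y w * l w)"
    using E unfolding E0_def by blast
  have X: "has_laplacian S (\<lambda>w. exp (E0 w)) (\<lambda>w. of_real (exp (E0 w)) * d' w)
      (\<lambda>w. exp (E0 w) * (cmod (d' w))\<^sup>2 + exp (E0 w) * l' w)"
    by (rule has_laplacian_compose[OF E]) (auto intro!: derivative_eq_intros continuous_intros)
  have eq: "exp (E0 w) = exp (\<psi> w) * Y w powr q" if "w \<in> S" for w
    using pos[OF that] by (simp add: E0_def exp_add powr_def)
  have "k w \<le> l' w" if w: "w \<in> S" for w
  proof -
    have "(cmod (d w))\<^sup>2 / (Y w)\<^sup>2 \<le> l w * Y w / (Y w)\<^sup>2"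
      using ls[OF w] by (intro divide_right_mono) auto
    also have "\<dots> = l w / Y w" using pos[OF w] by (simp add: power2_eq_square)
    finally show ?thesis unfolding l' using q by simp
  qed
  then have "exp (\<psi> w) * Y w powr q * k w \<le> exp (E0 w) * (cmod (d' w))\<^sup>2 + exp (E0 w) * l' w"
    if "w \<in> S" for w
    using that by (auto simp: eq[symmetric] intro!: add_increasing mult_left_mono)
  then show thesis
    using has_laplacian_cong[OF X S eq refl refl] by (rule that[rotated])
qed

lemma has_laplacian_norm2_eps:
  assumes "F holomorphic_on S" "open S"
  shows "has_laplacian S (\<lambda>w. (cmod (F w))\<^sup>2 + \<epsilon>) (\<lambda>w. 2 * cnj (F w) * deriv F w)
    (\<lambda>w. 4 * (cmod (deriv F w))\<^sup>2)"
  using has_laplacian_add[OF has_laplacian_norm2[OF assms] has_laplacian_const[of S \<epsilon>]] by simp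

text \<open>With \<open>s = \<bar>F\<bar>\<^sup>2 + \<epsilon>\<close> and \<open>v = (H, F)\<close>: for exponents \<open>q \<le> 1\<close> the Laplacian of
  \<open>(\<bar>v\<bar>\<^sup>2 + \<epsilon>)\<^sup>q\<close> is at most \<open>4 q s\<^bsup>q-1\<^esup> (\<bar>F'\<bar>\<^sup>2 + \<bar>F\<bar>\<^sup>2 \<bar>G'\<bar>\<^sup>2)\<close>, because \<open>F\<close> keeps \<open>v\<close> away from zero.
  The first two terms of the function absorb the two parts of this bound.\<close>

lemma bellman_function_concave:
  assumes S: "open S" and hol: "F holomorphic_on S" "H holomorphic_on S"
    and dH: "\<And>w. w \<in> S \<Longrightarrow> deriv H w = F w * deriv G w"
    and \<psi>: "has_laplacian S \<psi> e (\<lambda>w. 4 * (cmod (deriv G w))\<^sup>2 / M)" and M: "0 < M"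
    and \<psi>1: "\<And>w. w \<in> S \<Longrightarrow> - 1 \<le> \<psi> w" and \<epsilon>: "0 < \<epsilon>" and q: "0 < q" "q \<le> 1"
  obtains D L where "has_laplacian S (\<lambda>w. 1 / q * ((cmod (F w))\<^sup>2 + \<epsilon>) powr q
      + q * exp 1 * M * (exp (\<psi> w) * ((cmod (F w))\<^sup>2 + \<epsilon>) powr q)
      + (- 1) * ((cmod (H w))\<^sup>2 + ((cmod (F w))\<^sup>2 + \<epsilon>)) powr q) D L"
    "\<And>w. w \<in> S \<Longrightarrow> 0 \<le> L w"
proof -
  define s where "s = (\<lambda>w. (cmod (F w))\<^sup>2 + \<epsilon>)"
  define T where "T = (\<lambda>w. (cmod (H w))\<^sup>2 + s w)"
  have s: "has_laplacian S s (\<lambda>w. 2 * cnj (F w) * deriv F w) (\<lambda>w. 4 * (cmod (deriv F w))\<^sup>2)"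
    unfolding s_def by (rule has_laplacian_norm2_eps[OF hol(1) S])
  have s0: "0 < s w" "(cmod (F w))\<^sup>2 \<le> s w" "s w \<le> T w" "0 < T w" for w
    using \<epsilon> by (auto simp: s_def T_def add_nonneg_pos)
  have T: "has_laplacian S T (\<lambda>w. 2 * cnj (H w) * deriv H w + 2 * cnj (F w) * deriv F w)
      (\<lambda>w. 4 * (cmod (deriv H w))\<^sup>2 + 4 * (cmod (deriv F w))\<^sup>2)"
    unfolding T_def by (rule has_laplacian_add[OF has_laplacian_norm2[OF hol(2) S] s])
  have ls: "(cmod (2 * cnj (F w) * deriv F w))\<^sup>2 \<le> 4 * (cmod (deriv F w))\<^sup>2 * s w" for w
    using mult_left_mono[OF s0(2)[of w], of "4 * (cmod (deriv F w))\<^sup>2"]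
    by (simp add: norm_mult power_mult_distrib mult_ac)
  obtain D2 L2 where e: "has_laplacian S (\<lambda>w. exp (\<psi> w) * s w powr q) D2 L2"
    "\<And>w. w \<in> S \<Longrightarrow> exp (\<psi> w) * s w powr q * (4 * (cmod (deriv G w))\<^sup>2 / M) \<le> L2 w"
    using has_laplacian_exp_times_powr[OF s s0(1) ls less_imp_le[OF q(1)] S \<psi>] by blast
  define L where "L = (\<lambda>w. 1 / q * (q * (q - 1) * s w powr (q - 2) * (cmod (2 * cnj (F w) * deriv F w))\<^sup>2
               + q * s w powr (q - 1) * (4 * (cmod (deriv F w))\<^sup>2)) + q * exp 1 * M * L2 w
     + - 1 * (q * (q - 1) * T w powr (q - 2) * (cmod (2 * cnj (H w) * deriv H w + 2 * cnj (F w) * deriv F w))\<^sup>2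
               + q * T w powr (q - 1) * (4 * (cmod (deriv H w))\<^sup>2 + 4 * (cmod (deriv F w))\<^sup>2)))"
  have "\<exists>D. has_laplacian S (\<lambda>w. 1 / q * s w powr q + q * exp 1 * M * (exp (\<psi> w) * s w powr q)
      + (- 1) * T w powr q) D L"
    unfolding L_def
    by (rule exI, (rule has_laplacian_add has_laplacian_cmult has_laplacian_powr s T e(1) s0)+)
  then obtain D where U: "has_laplacian S (\<lambda>w. 1 / q * s w powr q + q * exp 1 * M * (exp (\<psi> w) * s w powr q)
      + (- 1) * T w powr q) D L" ..
  show thesis
  proof (rule that[OF U[unfolded T_def, unfolded s_def]])
    fix w assume w: "w \<in> S"
    let ?f = "(cmod (F w))\<^sup>2" and ?f' = "(cmod (deriv F w))\<^sup>2" and ?g' = "(cmod (deriv G w))\<^sup>2"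
    let ?dT = "(cmod (2 * cnj (H w) * deriv H w + 2 * cnj (F w) * deriv F w))\<^sup>2"
    let ?l1 = "1 / q * (q * (q - 1) * s w powr (q - 2) * (cmod (2 * cnj (F w) * deriv F w))\<^sup>2
               + q * s w powr (q - 1) * (4 * ?f'))"
    let ?l3 = "q * (q - 1) * T w powr (q - 2) * ?dT + q * T w powr (q - 1) * (4 * (cmod (deriv H w))\<^sup>2 + 4 * ?f')"
    have p1: "s w powr (q - 1) = s w powr (q - 2) * s w" and p2: "s w powr q = s w powr (q - 1) * s w"
      using s0(1)[of w] by (simp_all add: powr_diff power2_eq_square)
    \<comment> \<open>The gradient term is nonpositive and is estimated by |F|^2 \<le> s, which
      leaves the Laplacian of s^q at least 4 q^2 s^(q-1) |F'|^2. The coefficient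
      \<open>1 / q\<close> raises this to the 4 q s^(q-1) |F'|^2 that must be paid for.\<close>
    have "4 * q * ?f' * s w powr (q - 1) = 4 * ?f' * s w powr (q - 2) * ((q - 1) * s w + s w)"
      unfolding p1 by (simp add: algebra_simps)
    also have "\<dots> \<le> 4 * ?f' * s w powr (q - 2) * ((q - 1) * ?f + s w)"
      using q s0(2)[of w] by (intro mult_left_mono add_mono mult_left_mono_neg) auto
    also have "\<dots> = ?l1"
      unfolding p1 using q by (simp add: norm_mult power_mult_distrib field_simps)
    finally have 1: "4 * q * ?f' * s w powr (q - 1) \<le> ?l1" .
    \<comment> \<open>The lower bound -1 for \<open>\<psi>\<close> explains the factor
      \<open>exp 1\<close>; the factor \<open>q * M\<close> turns 4 |G'|^2 / M into the required 4 q
      |G'|^2.\<close>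
    have "1 \<le> exp 1 * exp (\<psi> w)"
      using \<psi>1[OF w] by (simp flip: exp_add)
    then have "4 * q * s w powr q * ?g' * 1 \<le> 4 * q * s w powr q * ?g' * (exp 1 * exp (\<psi> w))"
      using q by (intro mult_left_mono) auto
    also have "\<dots> = q * exp 1 * M * (exp (\<psi> w) * s w powr q * (4 * ?g' / M))"
      using M by (simp add: field_simps)
    also have "\<dots> \<le> q * exp 1 * M * L2 w"
      using e(2)[OF w] M q by (intro mult_left_mono) auto
    finally have 2: "4 * q * s w powr q * ?g' \<le> q * exp 1 * M * L2 w" by simp
    have "q * (q - 1) * T w powr (q - 2) * ?dT \<le> 0"
      using q by (simp add: mult_nonneg_nonpos mult_nonpos_nonneg)
    from this order_refl have "?l3 \<le> q * T w powr (q - 1) * (4 * (cmod (deriv H w))\<^sup>2 + 4 * ?f')"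
      by (rule add_decreasing)
    also have "\<dots> \<le> q * s w powr (q - 1) * (4 * (s w * ?g') + 4 * ?f')"
    proof -
      have "(cmod (deriv H w))\<^sup>2 \<le> s w * ?g'"
        unfolding dH[OF w] norm_mult power_mult_distrib using s0(2)[of w] by (intro mult_right_mono) auto
      then show ?thesis
        using q s0[of w] by (intro mult_mono powr_mono2' mult_left_mono) auto
    qed
    also have "\<dots> = 4 * q * ?f' * s w powr (q - 1) + 4 * q * s w powr q * ?g'"
      unfolding p2 by (simp add: algebra_simps)
    also have "\<dots> \<le> ?l1 + q * exp 1 * M * L2 w" by (rule add_mono[OF 1 2])
    finally show "0 \<le> L w"
      unfolding L_def by (simp only: mult_minus1 add_uminus_conv_diff diff_ge_0_iff_ge)
  qed
qed

text \<open>A form of Young's inequality: the first summand dominates when s \<le> \<delta> * T, the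
  second when T < s / \<delta>.\<close>

lemma powr_mult_le_split:
  fixes s T \<delta> q :: real
  assumes "0 < s" "0 < T" "0 < \<delta>" "1 \<le> q"
  shows "T powr (q - 1) * s \<le> \<delta> * T powr q + \<delta> powr (1 - q) * s powr q"
proof (cases "s \<le> \<delta> * T")
  case True
  then have "T powr (q - 1) * s \<le> T powr (q - 1) * (\<delta> * T)" by (intro mult_left_mono) auto
  also have "\<dots> = \<delta> * T powr q" using assms by (simp add: powr_diff)
  finally show ?thesis by (simp add: add_increasing2)
next
  case False
  then have "T powr (q - 1) * s \<le> (s / \<delta>) powr (q - 1) * s"
    using assms by (intro mult_right_mono powr_mono2) (auto simp: field_simps)
  also have "\<dots> = \<delta> powr (1 - q) * s powr q"
    using assms by (simp add: powr_diff powr_divide)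
  finally show ?thesis using assms by (simp add: add_increasing)
qed

text \<open>The Laplacian of \<open>(\<bar>H\<bar>\<^sup>2 + \<epsilon>)\<^sup>q\<close> is at most \<open>4 q\<^sup>2 (\<bar>H\<bar>\<^sup>2 + \<epsilon>)\<^bsup>q-1\<^esup> \<bar>F\<bar>\<^sup>2 \<bar>G'\<bar>\<^sup>2\<close>; Young's
  inequality distributes it over the two exponentially weighted terms.\<close>

lemma bellman_function_convex:
  assumes S: "open S" and hol: "F holomorphic_on S" "H holomorphic_on S"
    and dH: "\<And>w. w \<in> S \<Longrightarrow> deriv H w = F w * deriv G w"
    and \<psi>: "has_laplacian S \<psi> e (\<lambda>w. 4 * (cmod (deriv G w))\<^sup>2 / M)" and M: "0 < M"
    and \<psi>1: "\<And>w. w \<in> S \<Longrightarrow> - 1 \<le> \<psi> w" and \<epsilon>: "0 < \<epsilon>" and q: "1 \<le> q"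
    and B: "exp 1 * M * q\<^sup>2 * (1 / (2 * exp 1 * M * q\<^sup>2)) powr (1 - q) \<le> B"
  obtains D L where "has_laplacian S (\<lambda>w. B * (exp (\<psi> w) * ((cmod (F w))\<^sup>2 + \<epsilon>) powr q)
      + 1 / 2 * (exp (\<psi> w) * ((cmod (H w))\<^sup>2 + \<epsilon>) powr q)
      + (- 1) * ((cmod (H w))\<^sup>2 + \<epsilon>) powr q) D L"
    "\<And>w. w \<in> S \<Longrightarrow> 0 \<le> L w"
proof -
  define s where "s = (\<lambda>w. (cmod (F w))\<^sup>2 + \<epsilon>)"
  define T where "T = (\<lambda>w. (cmod (H w))\<^sup>2 + \<epsilon>)"
  \<comment> \<open>With this value the \<open>\<delta>\<close> part of Young's inequality equals
    what the term with coefficient \<open>1 / 2\<close> is guaranteed to supply when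
    \<open>\<psi>\<close> is at least -1. That coefficient is less than 1 so that, with \<psi> \<le>
    0, half of -T^q survives in the function.\<close>
  define \<delta> where "\<delta> = 1 / (2 * exp 1 * M * q\<^sup>2)"
  have \<delta>: "0 < \<delta>" using M q by (simp add: \<delta>_def)
  have B0: "0 \<le> B" using B M by (auto intro: order_trans[rotated])
  have s: "has_laplacian S s (\<lambda>w. 2 * cnj (F w) * deriv F w) (\<lambda>w. 4 * (cmod (deriv F w))\<^sup>2)"
    unfolding s_def by (rule has_laplacian_norm2_eps[OF hol(1) S])
  have T: "has_laplacian S T (\<lambda>w. 2 * cnj (H w) * deriv H w) (\<lambda>w. 4 * (cmod (deriv H w))\<^sup>2)"
    unfolding T_def by (rule has_laplacian_norm2_eps[OF hol(2) S])
  have s0: "0 < s w" "(cmod (F w))\<^sup>2 \<le> s w" "0 < T w" "(cmod (H w))\<^sup>2 \<le> T w" for w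
    using \<epsilon> by (auto simp: s_def T_def add_nonneg_pos)
  have ls: "(cmod (2 * cnj (F w) * deriv F w))\<^sup>2 \<le> 4 * (cmod (deriv F w))\<^sup>2 * s w" for w
    using mult_left_mono[OF s0(2)[of w], of "4 * (cmod (deriv F w))\<^sup>2"]
    by (simp add: norm_mult power_mult_distrib mult_ac)
  have lT: "(cmod (2 * cnj (H w) * deriv H w))\<^sup>2 \<le> 4 * (cmod (deriv H w))\<^sup>2 * T w" for w
    using mult_left_mono[OF s0(4)[of w], of "4 * (cmod (deriv H w))\<^sup>2"]
    by (simp add: norm_mult power_mult_distrib mult_ac)
  have q0: "0 \<le> q" using q by simp
  obtain D1 L1 where e1: "has_laplacian S (\<lambda>w. exp (\<psi> w) * s w powr q) D1 L1"
    "\<And>w. w \<in> S \<Longrightarrow> exp (\<psi> w) * s w powr q * (4 * (cmod (deriv G w))\<^sup>2 / M) \<le> L1 w"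
    using has_laplacian_exp_times_powr[OF s s0(1) ls q0 S \<psi>] by blast
  obtain D2 L2 where e2: "has_laplacian S (\<lambda>w. exp (\<psi> w) * T w powr q) D2 L2"
    "\<And>w. w \<in> S \<Longrightarrow> exp (\<psi> w) * T w powr q * (4 * (cmod (deriv G w))\<^sup>2 / M) \<le> L2 w"
    using has_laplacian_exp_times_powr[OF T s0(3) lT q0 S \<psi>] by blast
  define L where "L = (\<lambda>w. B * L1 w + 1 / 2 * L2 w
     + - 1 * (q * (q - 1) * T w powr (q - 2) * (cmod (2 * cnj (H w) * deriv H w))\<^sup>2
               + q * T w powr (q - 1) * (4 * (cmod (deriv H w))\<^sup>2)))"
  have "\<exists>D. has_laplacian S (\<lambda>w. B * (exp (\<psi> w) * s w powr q) + 1 / 2 * (exp (\<psi> w) * T w powr q)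
      + (- 1) * T w powr q) D L"
    unfolding L_def
    by (rule exI, (rule has_laplacian_add has_laplacian_cmult has_laplacian_powr T e1(1) e2(1) s0)+)
  then obtain D where U: "has_laplacian S (\<lambda>w. B * (exp (\<psi> w) * s w powr q) + 1 / 2 * (exp (\<psi> w) * T w powr q)
      + (- 1) * T w powr q) D L" ..
  show thesis
  proof (rule that[OF U[unfolded T_def, unfolded s_def]])
    fix w assume w: "w \<in> S"
    let ?g' = "(cmod (deriv G w))\<^sup>2"
    let ?l3 = "q * (q - 1) * T w powr (q - 2) * (cmod (2 * cnj (H w) * deriv H w))\<^sup>2
       + q * T w powr (q - 1) * (4 * (cmod (deriv H w))\<^sup>2)"
    have p1: "T w powr (q - 1) = T w powr (q - 2) * T w"
      using s0(3)[of w] by (simp_all add: powr_diff power2_eq_square)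
    have ex: "exp (- 1) \<le> exp (\<psi> w)" using \<psi>1[OF w] by simp
    have "exp (- 1) * s w powr q * (4 * ?g' / M) \<le> L1 w"
      by (rule order_trans[OF _ e1(2)[OF w]]) (use ex M in \<open>intro mult_right_mono, auto\<close>)
    then have "B * (exp (- 1) * s w powr q * (4 * ?g' / M)) \<le> B * L1 w"
      using B0 by (rule mult_left_mono)
    moreover have "exp 1 * M * q\<^sup>2 * \<delta> powr (1 - q) * (exp (- 1) * s w powr q * (4 * ?g' / M)) \<le> 
        B * (exp (- 1) * s w powr q * (4 * ?g' / M))"
      using B M unfolding \<delta>_def by (intro mult_right_mono) auto
    moreover have "exp 1 * M * q\<^sup>2 * \<delta> powr (1 - q) * (exp (- 1) * s w powr q * (4 * ?g' / M)) =
       4 * q\<^sup>2 * ?g' * (\<delta> powr (1 - q) * s w powr q)"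
      using M by (simp add: exp_minus field_simps)
    ultimately have 1: "4 * q\<^sup>2 * ?g' * (\<delta> powr (1 - q) * s w powr q) \<le> B * L1 w" by linarith
    have "exp (- 1) * T w powr q * (4 * ?g' / M) \<le> L2 w"
      by (rule order_trans[OF _ e2(2)[OF w]]) (use ex M in \<open>intro mult_right_mono, auto\<close>)
    moreover have "4 * q\<^sup>2 * ?g' * (\<delta> * T w powr q) = 1 / 2 * (exp (- 1) * T w powr q * (4 * ?g' / M))"
      using M q by (simp add: \<delta>_def exp_minus field_simps)
    ultimately have 2: "4 * q\<^sup>2 * ?g' * (\<delta> * T w powr q) \<le> 1 / 2 * L2 w"
      by (simp only: mult_left_mono)
    \<comment> \<open>The squared gradient of \<open>T\<close> is 4 |H|^2 |H'|^2 and |H|^2 \<le> T,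
      so the two parts of the Laplacian of T^q combine with the factor q (q - 1) + q = q^2.\<close>
    have "?l3 = 4 * q * (cmod (deriv H w))\<^sup>2 * T w powr (q - 2) * ((q - 1) * (cmod (H w))\<^sup>2 + T w)"
      unfolding p1 by (simp add: norm_mult power_mult_distrib algebra_simps)
    also have "\<dots> \<le> 4 * q * (cmod (deriv H w))\<^sup>2 * T w powr (q - 2) * ((q - 1) * T w + T w)"
      using q s0(4)[of w] by (intro mult_left_mono add_mono) auto
    also have "\<dots> = 4 * q\<^sup>2 * (cmod (deriv H w))\<^sup>2 * T w powr (q - 1)"
      unfolding p1 by (simp add: power2_eq_square algebra_simps)
    also have "\<dots> \<le> 4 * q\<^sup>2 * (s w * ?g') * T w powr (q - 1)"
      unfolding dH[OF w] norm_mult power_mult_distrib using s0(2)[of w]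
      by (intro mult_right_mono mult_left_mono) auto
    also have "\<dots> = 4 * q\<^sup>2 * ?g' * (T w powr (q - 1) * s w)" by simp
    also have "\<dots> \<le> 4 * q\<^sup>2 * ?g' * (\<delta> * T w powr q + \<delta> powr (1 - q) * s w powr q)"
      using s0[of w] \<delta> q by (intro mult_left_mono powr_mult_le_split) auto
    also have "\<dots> = 4 * q\<^sup>2 * ?g' * (\<delta> * T w powr q) + 4 * q\<^sup>2 * ?g' * (\<delta> powr (1 - q) * s w powr q)"
      by (rule distrib_left)
    also have "\<dots> \<le> 1 / 2 * L2 w + B * L1 w" by (rule add_mono[OF 2 1])
    finally show "0 \<le> L w" unfolding L_def by simp
  qed
qed

section \<open>From the Bellman functions to bounds for circle means\<close>

lemma power2_powr_half: "0 \<le> x \<Longrightarrow> (x\<^sup>2) powr (p / 2) = x powr p" for x p :: real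
  by (cases "x = 0") (auto simp: powr_powr simp flip: powr_numeral)

lemma deriv_compose_exp:
  assumes "u holomorphic_on ball 0 s" "0 < s" "Re w < ln s"
  shows "deriv (\<lambda>w. u (exp w)) w = deriv u (exp w) * exp w"
proof -
  have "cmod (exp w) < s" using assms by (metis exp_less_cancel_iff exp_ln norm_exp_eq_Re)
  then have "(u has_field_derivative deriv u (exp w)) (at (exp w))"
    using holomorphic_derivI[OF assms(1)] by simp
  from DERIV_chain2[OF this DERIV_exp] show ?thesis by (rule DERIV_imp_deriv)
qed

lemma holomorphic_compose_exp:
  assumes "u holomorphic_on ball 0 s" "0 < s"
  shows "(\<lambda>w. u (exp w)) holomorphic_on {w. Re w < ln s}"
proof -
  have "exp ` {w. Re w < ln s} \<subseteq> ball 0 s"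
    using assms by (auto simp: dist_norm) (metis exp_less_cancel_iff exp_ln)
  then show ?thesis
    using holomorphic_on_compose_gen[OF holomorphic_on_exp assms(1)] by (simp add: o_def)
qed

text \<open>The Bellman function enters as \<open>U\<close>: its mean is at least U 0 and hence
  nonnegative, and since \<open>U\<close> lies below v - u on the circle, the mean of v - u is
  nonnegative too. The comparison is needed on that circle only.\<close>

lemma circle_mean_estimate_via_subharmonic:
  assumes s: "0 < r" "r < s" and U: "continuous_on (ball 0 s) U"
    and lap: "has_laplacian {w. Re w < ln s} (\<lambda>w. U (exp w)) d l" "\<And>w. Re w < ln s \<Longrightarrow> 0 \<le> l w"
    and U0: "0 \<le> U 0"
    and uv: "continuous_on (ball 0 s) u" "continuous_on (ball 0 s) v"
    and le: "\<And>z. cmod z = r \<Longrightarrow> U z \<le> v z - u z"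
  shows "circle_mean r u \<le> circle_mean r v"
proof -
  have c: "continuous_on (sphere 0 r) U" "continuous_on (sphere 0 r) u" "continuous_on (sphere 0 r) v"
    using U uv s by (auto elim!: continuous_on_subset)
  have "0 \<le> 2 * pi * U 0" using U0 by simp
  also have "\<dots> \<le> integral {0..2*pi} (\<lambda>t. U (of_real r * cis t))"
    using s by (intro sub_mean_value[OF _ U lap]) auto
  finally have "0 \<le> circle_mean r U" by (simp add: circle_mean_def)
  then have "circle_mean r u \<le> circle_mean r u + circle_mean r U" by simp
  also have "\<dots> = circle_mean r (\<lambda>z. u z + U z)"
    using c s by (intro circle_mean_add[symmetric]) auto
  also have "\<dots> \<le> circle_mean r v"
    using c s le by (intro circle_mean_mono continuous_intros) (auto simp: algebra_simps)
  finally show ?thesis .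
qed

text \<open>Removes the regularisation. Since the exponent is positive, the integrand is jointly
  continuous down to \<open>\<epsilon> = 0\<close>, also at zeros of \<open>f\<close>.\<close>

lemma circle_mean_eps_limit:
  fixes f :: "complex \<Rightarrow> complex"
  assumes f: "continuous_on (sphere 0 r) f" and r: "0 \<le> r" and q: "0 < q"
    and le: "\<And>\<epsilon>. 0 < \<epsilon> \<Longrightarrow> a \<le> C * circle_mean r (\<lambda>z. ((cmod (f z))\<^sup>2 + \<epsilon>) powr q)"
  shows "a \<le> C * circle_mean r (\<lambda>z. ((cmod (f z))\<^sup>2) powr q)"
proof -
  define I where "I = (\<lambda>\<epsilon>. circle_mean r (\<lambda>z. ((cmod (f z))\<^sup>2 + \<epsilon>) powr q))"
  have "continuous_on ({0..} \<times> cbox 0 (2 * pi))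
      (\<lambda>(\<epsilon>, t). ((cmod (f (of_real r * cis t)))\<^sup>2 + \<epsilon>) powr q)"
  proof -
    have "continuous_on ({0..} \<times> cbox 0 (2 * pi)) (\<lambda>x::real \<times> real. f (of_real r * cis (snd x)))"
      by (rule continuous_on_compose2[OF f]) (use r in \<open>auto intro!: continuous_intros simp: norm_mult\<close>)
    then show ?thesis
      unfolding case_prod_beta using q by (intro continuous_on_powr' continuous_intros) auto
  qed
  then have "continuous_on {0..} I"
    unfolding I_def circle_mean_def cbox_interval[symmetric]
    by (intro continuous_intros integral_continuous_on_param)
  then have "(I \<longlongrightarrow> I 0) (at 0 within {0..})" by (simp add: continuous_on_def)
  then have "(I \<longlongrightarrow> I 0) (at_right 0)"
    by (rule tendsto_within_subset) auto
  then have "((\<lambda>\<epsilon>. C * I \<epsilon>) \<longlongrightarrow> C * I 0) (at_right 0)" by (intro tendsto_intros)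
  moreover have "\<forall>\<^sub>F \<epsilon> in at_right 0. a \<le> C * I \<epsilon>"
    using le unfolding I_def by (auto simp: eventually_at_right_field intro!: exI[of _ 1])
  ultimately have "a \<le> C * I 0"
    by (rule tendsto_lowerbound) simp
  then show ?thesis by (simp add: I_def)
qed

text \<open>\<open>C\<close> is chosen before \<open>f\<close>, \<open>h\<close> and
  \<open>r\<close>; this uniformity is the boundedness of the operator. The normalisation
  \<open>h 0 = 0\<close> is what makes the Bellman functions nonnegative at the origin.\<close>

lemma volterra_circle_mean_estimate:
  fixes p M :: real
  assumes p: "0 < p" and M: "0 < M" and g: "g holomorphic_on ball 0 1"
    and bmo: "\<And>a r. cmod a < 1 \<Longrightarrow> 0 < r \<Longrightarrow> r < 1 \<Longrightarrow>
      circle_mean r (\<lambda>z. (cmod (g (disk_involution a z) - g a))\<^sup>2) \<le> M"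
  obtains C where "0 \<le> C"
    "\<And>f h r. f holomorphic_on ball 0 1 \<Longrightarrow>
       (\<And>z. cmod z < 1 \<Longrightarrow> (h has_field_derivative f z * deriv g z) (at z)) \<Longrightarrow> h 0 = 0 \<Longrightarrow> 0 < r \<Longrightarrow> r < 1 \<Longrightarrow>
       circle_mean r (\<lambda>z. cmod (h z) powr p) \<le> C * circle_mean r (\<lambda>z. cmod (f z) powr p)"
proof -
  define q where "q = p / 2"
  have q: "0 < q" using p by (simp add: q_def)
  \<comment> \<open>The first summand is what the convex Bellman function demands. The extra
    \<open>exp 1\<close> ensures that B * exp (\<psi> 0) is at least 1, so that this function is
    nonnegative at 0.\<close>
  define B where "B = exp 1 * M * q\<^sup>2 * (1 / (2 * exp 1 * M * q\<^sup>2)) powr (1 - q) + exp 1"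
  have B: "exp 1 * M * q\<^sup>2 * (1 / (2 * exp 1 * M * q\<^sup>2)) powr (1 - q) \<le> B" "exp 1 \<le> B"
    using M by (auto simp: B_def)
  have B0: "0 < B" using B(2) exp_gt_zero[of "1::real"] by linarith
  \<comment> \<open>For \<open>q \<le> 1\<close> the two coefficients of the powers of
    \<open>f\<close> add up, because exp \<psi> \<le> 1. For larger \<open>q\<close> only half of
    |h|^p is bounded by \<open>B\<close> times the mean of \<open>f\<close>, hence the factor
    2.\<close>
  define C where "C = (if q \<le> 1 then 1 / q + q * exp 1 * M else 2 * B)"
  have C0: "0 \<le> C" using q M B0 by (auto simp: C_def)
  show thesis
  proof (rule that[OF C0])
    fix f h :: "complex \<Rightarrow> complex" and r :: real
    assume f: "f holomorphic_on ball 0 1"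
      and h: "\<And>z. cmod z < 1 \<Longrightarrow> (h has_field_derivative f z * deriv g z) (at z)"
      and h0: "h 0 = 0" and r: "0 < r" "r < 1"
    define s where "s = (1 + r) / 2"
    have s: "r < s" "0 < s" "s < 1" using r by (auto simp: s_def)
    obtain K where K: "K holomorphic_on ball 0 s"
      "\<And>z. cmod z < s \<Longrightarrow> (cmod (g z))\<^sup>2 \<le> Re (K z)"
      "\<And>z. cmod z < s \<Longrightarrow> Re (K z) \<le> (cmod (g z))\<^sup>2 + M"
      using bmoa_harmonic_majorant[OF g bmo s(2,3)] by blast
    have hh: "h holomorphic_on ball 0 1"
      unfolding holomorphic_on_open[OF open_ball] using h mem_ball_0 by blast
    have hol: "f holomorphic_on ball 0 s" "g holomorphic_on ball 0 s" "h holomorphic_on ball 0 s"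
      using f g hh s by (auto elim!: holomorphic_on_subset)
    define \<psi> where "\<psi> = (\<lambda>z. 1 / M * ((cmod (g z))\<^sup>2 + (- 1) * Re (K z)))"
    have \<psi>: "- 1 \<le> \<psi> z" "\<psi> z \<le> 0" if "cmod z < s" for z
      using K(2,3)[OF that] M by (auto simp: \<psi>_def field_simps)
    have cont: "continuous_on (ball 0 s) f" "continuous_on (ball 0 s) h" "continuous_on (ball 0 s) \<psi>"
      unfolding \<psi>_def using hol K(1) M by (auto intro!: continuous_intros dest: holomorphic_on_imp_continuous_on)
    let ?S = "{w. Re w < ln s}"
    have S: "open ?S" by (simp add: open_halfspace_Re_lt)
    have exS: "cmod (exp w) < s" if "w \<in> ?S" for w
      using that s by simp (metis exp_less_cancel_iff exp_ln)
    let ?F = "\<lambda>w. f (exp w)" and ?G = "\<lambda>w. g (exp w)" and ?H = "\<lambda>w. h (exp w)"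
    have holS: "?F holomorphic_on ?S" "?G holomorphic_on ?S" "?H holomorphic_on ?S" "(\<lambda>w. K (exp w)) holomorphic_on ?S"
      using hol K(1) s holomorphic_compose_exp by auto
    have dH: "deriv ?H w = ?F w * deriv ?G w" if "w \<in> ?S" for w
    proof -
      have "cmod (exp w) < 1" by (rule less_trans[OF exS[OF that] s(3)])
      then have "deriv h (exp w) = f (exp w) * deriv g (exp w)" using h by (intro DERIV_imp_deriv)
      then show ?thesis using hol s that by (simp add: deriv_compose_exp)
    qed
    obtain e where \<psi>lap: "has_laplacian ?S (\<lambda>w. \<psi> (exp w)) e (\<lambda>w. 4 * (cmod (deriv ?G w))\<^sup>2 / M)"
      using has_laplacian_cmult[OF has_laplacian_add[OF has_laplacian_norm2[OF holS(2) S]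
          has_laplacian_cmult[OF has_laplacian_Re[OF holS(4) S], of "- 1"]], of "1 / M"]
      unfolding \<psi>_def by fastforce
    have \<psi>1: "- 1 \<le> \<psi> (exp w)" if "w \<in> ?S" for w using \<psi>(1)[OF exS[OF that]] .
    have "circle_mean r (\<lambda>z. cmod (h z) powr p) \<le> C * circle_mean r (\<lambda>z. ((cmod (f z))\<^sup>2 + \<epsilon>) powr q)"
      if \<epsilon>: "0 < \<epsilon>" for \<epsilon>
    proof -
      have pos: "0 < (cmod z)\<^sup>2 + \<epsilon>" for z using \<epsilon> by (simp add: add_nonneg_pos)
      have nz: "(cmod z)\<^sup>2 + \<epsilon> \<noteq> 0" "(cmod z)\<^sup>2 + ((cmod w)\<^sup>2 + \<epsilon>) \<noteq> 0" for z w
        using pos[of z] pos[of w] by (auto simp: add_nonneg_eq_0_iff)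
      have hp: "cmod (h z) powr p \<le> x powr q" if "(cmod (h z))\<^sup>2 \<le> x" for x z
        using power2_powr_half[of "cmod (h z)" p] powr_mono2[OF less_imp_le[OF q] _ that] by (simp add: q_def)
      have ch: "continuous_on (ball 0 s) (\<lambda>z. cmod (h z) powr p)"
        using cont p by (intro continuous_on_powr' continuous_intros) auto
      show ?thesis
      proof (cases "q \<le> 1")
        case True
        let ?U = "\<lambda>z. 1 / q * ((cmod (f z))\<^sup>2 + \<epsilon>) powr q
            + q * exp 1 * M * (exp (\<psi> z) * ((cmod (f z))\<^sup>2 + \<epsilon>) powr q)
            + (- 1) * ((cmod (h z))\<^sup>2 + ((cmod (f z))\<^sup>2 + \<epsilon>)) powr q"
        obtain D L where L: "has_laplacian ?S (\<lambda>w. ?U (exp w)) D L" "\<And>w. w \<in> ?S \<Longrightarrow> 0 \<le> L w"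
          by (rule bellman_function_concave[OF S holS(1,3) dH \<psi>lap M \<psi>1 \<epsilon> q True]) blast+
        have "circle_mean r (\<lambda>z. cmod (h z) powr p) \<le> circle_mean r (\<lambda>z. C * ((cmod (f z))\<^sup>2 + \<epsilon>) powr q)"
        proof (rule circle_mean_estimate_via_subharmonic[OF r(1) s(1) _ L(1)])
          show "0 \<le> L w" if "Re w < ln s" for w using L(2) that by simp
          show "continuous_on (ball 0 s) ?U"
            using nz by (intro continuous_intros cont) auto
          show "continuous_on (ball 0 s) (\<lambda>z. C * ((cmod (f z))\<^sup>2 + \<epsilon>) powr q)"
            using nz by (intro continuous_intros cont) auto
          \<comment> \<open>At the origin the negative term reduces to (|f 0|^2 + \<epsilon>)^q
            because \<open>h\<close> vanishes there; the coefficient \<open>1 / q\<close>, at least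
            1, pays for it.\<close>
          have "1 * ((cmod (f 0))\<^sup>2 + \<epsilon>) powr q \<le> 1 / q * ((cmod (f 0))\<^sup>2 + \<epsilon>) powr q"
            using True q by (intro mult_right_mono) auto
          moreover have "0 \<le> q * exp 1 * M * (exp (\<psi> 0) * ((cmod (f 0))\<^sup>2 + \<epsilon>) powr q)"
            using q M by simp
          ultimately show "0 \<le> ?U 0" using h0 by simp
          show "?U z \<le> C * ((cmod (f z))\<^sup>2 + \<epsilon>) powr q - cmod (h z) powr p" if z: "cmod z = r" for z
          proof -
            have "exp (\<psi> z) * ((cmod (f z))\<^sup>2 + \<epsilon>) powr q \<le> 1 * ((cmod (f z))\<^sup>2 + \<epsilon>) powr q"
              using \<psi>(2)[of z] z s by (intro mult_right_mono) auto
            then have "q * exp 1 * M * (exp (\<psi> z) * ((cmod (f z))\<^sup>2 + \<epsilon>) powr q)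
                \<le> q * exp 1 * M * ((cmod (f z))\<^sup>2 + \<epsilon>) powr q"
              using q M by (intro mult_left_mono) auto
            moreover have "cmod (h z) powr p \<le> ((cmod (h z))\<^sup>2 + ((cmod (f z))\<^sup>2 + \<epsilon>)) powr q"
              using \<epsilon> by (intro hp) auto
            ultimately show ?thesis using True by (simp add: C_def distrib_right)
          qed
        qed (rule ch)
        then show ?thesis by simp
      next
        case False
        then have q1: "1 \<le> q" by simp
        let ?U = "\<lambda>z. B * (exp (\<psi> z) * ((cmod (f z))\<^sup>2 + \<epsilon>) powr q)
            + 1 / 2 * (exp (\<psi> z) * ((cmod (h z))\<^sup>2 + \<epsilon>) powr q)
            + (- 1) * ((cmod (h z))\<^sup>2 + \<epsilon>) powr q"
        obtain D L where L: "has_laplacian ?S (\<lambda>w. ?U (exp w)) D L" "\<And>w. w \<in> ?S \<Longrightarrow> 0 \<le> L w"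
          by (rule bellman_function_convex[OF S holS(1,3) dH \<psi>lap M \<psi>1 \<epsilon> q1 B(1)]) blast+
        have "circle_mean r (\<lambda>z. 1 / 2 * cmod (h z) powr p) \<le> circle_mean r (\<lambda>z. B * ((cmod (f z))\<^sup>2 + \<epsilon>) powr q)"
        proof (rule circle_mean_estimate_via_subharmonic[OF r(1) s(1) _ L(1)])
          show "0 \<le> L w" if "Re w < ln s" for w using L(2) that by simp
          show "continuous_on (ball 0 s) ?U"
            using nz by (intro continuous_intros cont) auto
          show "continuous_on (ball 0 s) (\<lambda>z. B * ((cmod (f z))\<^sup>2 + \<epsilon>) powr q)"
            using nz by (intro continuous_intros cont) auto
          show "continuous_on (ball 0 s) (\<lambda>z. 1 / 2 * cmod (h z) powr p)"
            by (intro continuous_intros ch)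
          have "1 \<le> exp 1 * exp (\<psi> 0)" using \<psi>(1)[of 0] s by (simp flip: exp_add)
          also have "\<dots> \<le> B * exp (\<psi> 0)" using B(2) by (intro mult_right_mono) auto
          finally have "1 * \<epsilon> powr q \<le> (B * exp (\<psi> 0)) * ((cmod (f 0))\<^sup>2 + \<epsilon>) powr q"
            using \<epsilon> q by (intro mult_mono powr_mono2) auto
          moreover have "0 \<le> 1 / 2 * (exp (\<psi> 0) * \<epsilon> powr q)" by simp
          ultimately show "0 \<le> ?U 0" using h0 by (simp add: mult.assoc add_increasing2)
          show "?U z \<le> B * ((cmod (f z))\<^sup>2 + \<epsilon>) powr q - 1 / 2 * cmod (h z) powr p" if z: "cmod z = r" for z
          proof -
            have ex: "exp (\<psi> z) \<le> 1" using \<psi>(2)[of z] z s by simp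
            have "B * (exp (\<psi> z) * ((cmod (f z))\<^sup>2 + \<epsilon>) powr q) \<le> B * (1 * ((cmod (f z))\<^sup>2 + \<epsilon>) powr q)"
              using ex B0 by (intro mult_left_mono mult_right_mono) auto
            moreover have "exp (\<psi> z) * ((cmod (h z))\<^sup>2 + \<epsilon>) powr q \<le> 1 * ((cmod (h z))\<^sup>2 + \<epsilon>) powr q"
              using ex by (intro mult_right_mono) auto
            moreover have "cmod (h z) powr p \<le> ((cmod (h z))\<^sup>2 + \<epsilon>) powr q"
              using \<epsilon> by (intro hp) auto
            ultimately show ?thesis by simp
          qed
        qed
        then show ?thesis using False unfolding circle_mean_cmult by (simp add: C_def)
      qed
    qed
    then have "circle_mean r (\<lambda>z. cmod (h z) powr p) \<le> C * circle_mean r (\<lambda>z. ((cmod (f z))\<^sup>2) powr q)"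
      using cont(1) r s q by (intro circle_mean_eps_limit) (auto elim: continuous_on_subset)
    then show "circle_mean r (\<lambda>z. cmod (h z) powr p) \<le> C * circle_mean r (\<lambda>z. cmod (f z) powr p)"
      by (simp add: q_def power2_powr_half)
  qed
qed

section \<open>Fourier coefficients on circles\<close>

lemma circle_mean_sums:
  fixes u :: "nat \<Rightarrow> complex \<Rightarrow> 'a::banach"
  assumes cont: "\<And>n. continuous_on (sphere 0 r) (u n)" and r: "0 \<le> r"
    and bd: "\<And>n \<zeta>. cmod \<zeta> = r \<Longrightarrow> norm (u n \<zeta>) \<le> B n" and B: "summable B"
  shows "(\<lambda>n. circle_mean r (u n)) sums circle_mean r (\<lambda>\<zeta>. \<Sum>n. u n \<zeta>)"
proof -
  let ?c = "\<lambda>t. of_real r * cis t"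
  have ul: "uniform_limit {0..2*pi} (\<lambda>n t. \<Sum>i<n. u i (?c t)) (\<lambda>t. \<Sum>i. u i (?c t)) sequentially"
    by (rule Weierstrass_m_test[OF _ B]) (use r bd in \<open>auto simp: norm_mult\<close>)
  have c: "continuous_on {0..2*pi} (\<lambda>t. u i (?c t))" for i
    by (rule continuous_on_compose2[OF cont[of i]]) (use r in \<open>auto intro!: continuous_intros simp: norm_mult\<close>)
  obtain I J where I: "\<And>n. ((\<lambda>t. \<Sum>i<n. u i (?c t)) has_integral I n) {0..2*pi}"
    "((\<lambda>t. \<Sum>i. u i (?c t)) has_integral J) {0..2*pi}" "I \<longlonglongrightarrow> J"
    by (rule uniform_limit_integral[OF ul]) (auto intro!: continuous_intros c)
  have "I n = (\<Sum>i<n. integral {0..2*pi} (\<lambda>t. u i (?c t)))" for n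
    using I(1)[of n] by (simp add: has_integral_iff integral_sum integrable_continuous_interval c)
  then have "I = (\<lambda>n. \<Sum>i<n. integral {0..2*pi} (\<lambda>t. u i (?c t)))" by blast
  with I(3) have "(\<lambda>i. integral {0..2*pi} (\<lambda>t. u i (?c t))) sums J"
    by (simp only: sums_def)
  then have "(\<lambda>i. integral {0..2*pi} (\<lambda>t. u i (?c t)) /\<^sub>R (2 * pi)) sums (J /\<^sub>R (2 * pi))"
    by (rule sums_scaleR_right)
  then show ?thesis
    using I(2) by (simp add: circle_mean_def has_integral_iff)
qed

lemma circle_mean_norm_le:
  fixes u :: "complex \<Rightarrow> 'a::banach"
  assumes u: "continuous_on (sphere 0 r) u" and r: "0 \<le> r"
  shows "norm (circle_mean r u) \<le> circle_mean r (\<lambda>\<zeta>. norm (u \<zeta>))"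
proof -
  have "norm (integral {0..2*pi} (\<lambda>t. u (of_real r * cis t))) \<le> integral {0..2*pi} (\<lambda>t. norm (u (of_real r * cis t)))"
    using integrable_on_circle[OF u r] integrable_on_circle[OF continuous_on_norm[OF u] r]
    by (intro integral_norm_bound_integral) auto
  then show ?thesis by (simp add: circle_mean_def divide_right_mono)
qed

text \<open>For k \<ge> m the integrand equals r^(2m) times a power of \<zeta> on the circle, whose
  mean is its value at the centre; \<open>0 ^ j\<close> is 1 exactly for \<open>j = 0\<close>. The
  case k < m follows by conjugation.\<close>

lemma circle_mean_power_cnj_power:
  assumes r: "0 < r"
  shows "circle_mean r (\<lambda>\<zeta>. \<zeta> ^ k * cnj \<zeta> ^ m) = (if k = m then of_real (r ^ (2 * m)) else 0)"
proof -
  have *: "circle_mean r (\<lambda>\<zeta>. \<zeta> ^ (m + j) * cnj \<zeta> ^ m) = of_real (r ^ (2 * m)) * 0 ^ j" for m j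
  proof -
    have "circle_mean r (\<lambda>\<zeta>. \<zeta> ^ (m + j) * cnj \<zeta> ^ m) = circle_mean r (\<lambda>\<zeta>. of_real (r ^ (2 * m)) * \<zeta> ^ j)"
    proof (rule circle_mean_cong)
      fix \<zeta> assume "cmod \<zeta> = r"
      then have "\<zeta> * cnj \<zeta> = of_real (r\<^sup>2)" using complex_norm_square[of \<zeta>] by simp
      moreover have "\<zeta> ^ (m + j) * cnj \<zeta> ^ m = (\<zeta> * cnj \<zeta>) ^ m * \<zeta> ^ j"
        by (simp add: power_add power_mult_distrib)
      ultimately show "\<zeta> ^ (m + j) * cnj \<zeta> ^ m = of_real (r ^ (2 * m)) * \<zeta> ^ j"
        by (simp add: power_mult)
    qed (use r in simp)
    also have "\<dots> = of_real (r ^ (2 * m)) * 0 ^ j"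
      using r by (subst circle_mean_holomorphic) (auto intro!: continuous_intros holomorphic_intros)
    finally show ?thesis .
  qed
  show ?thesis
  proof (cases "m \<le> k")
    case True
    then show ?thesis using *[of m "k - m"] by (auto simp: power_0_left)
  next
    case False
    have "circle_mean r (\<lambda>\<zeta>. \<zeta> ^ k * cnj \<zeta> ^ m) = circle_mean r (\<lambda>\<zeta>. cnj (\<zeta> ^ (k + (m - k)) * cnj \<zeta> ^ k))"
      using False by (simp add: mult.commute)
    also have "\<dots> = cnj (circle_mean r (\<lambda>\<zeta>. \<zeta> ^ (k + (m - k)) * cnj \<zeta> ^ k))"
      using r by (intro circle_mean_linear bounded_linear_cnj continuous_intros) auto
    finally show ?thesis using *[of k "m - k"] False by (simp add: power_0_left)
  qed
qed

text \<open>Pairs a function with its coefficients, so that Taylor expansions of given functions and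
  series built by hand are treated alike.\<close>

locale disk_power_series =
  fixes a :: "nat \<Rightarrow> complex" and f :: "complex \<Rightarrow> complex"
  assumes sums: "cmod z < 1 \<Longrightarrow> (\<lambda>n. a n * z ^ n) sums f z"
begin

lemma holomorphic: "f holomorphic_on ball 0 1"
  by (rule power_series_holomorphic[of 0 1 a]) (simp add: sums)

lemma continuous_on_circle: "r < 1 \<Longrightarrow> continuous_on (sphere 0 r) f"
  using holomorphic_on_imp_continuous_on[OF holomorphic] by (auto elim!: continuous_on_subset)

lemma summable_norm: assumes "0 \<le> r" "r < 1" shows "summable (\<lambda>n. cmod (a n) * r ^ n)"
proof -
  obtain x where x: "r < x" "x < 1" using dense[OF assms(2)] by blast
  have "cmod (of_real x) < 1" "cmod (of_real r) < cmod (of_real x)" using x assms by auto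
  then have "summable (\<lambda>n. norm (a n * of_real r ^ n))"
    using powser_insidea[of a "of_real x" "of_real r"] sums[of "of_real x"] sums_summable by blast
  then show ?thesis using assms by (simp add: norm_mult norm_power)
qed

lemma circle_mean_coeff:
  assumes r: "0 < r" "r < 1"
  shows "circle_mean r (\<lambda>\<zeta>. f \<zeta> * cnj \<zeta> ^ m) = a m * of_real (r ^ (2 * m))"
proof -
  let ?u = "\<lambda>n \<zeta>. a n * (\<zeta> ^ n * cnj \<zeta> ^ m)"
  have "(\<lambda>n. circle_mean r (?u n)) sums circle_mean r (\<lambda>\<zeta>. \<Sum>n. ?u n \<zeta>)"
  proof (rule circle_mean_sums)
    show "norm (?u n \<zeta>) \<le> (cmod (a n) * r ^ n) * r ^ m" if "cmod \<zeta> = r" for n \<zeta>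
      using that by (simp add: norm_mult norm_power)
    show "summable (\<lambda>n. (cmod (a n) * r ^ n) * r ^ m)"
      using summable_norm r by (intro summable_mult2) auto
  qed (use r in \<open>auto intro!: continuous_intros\<close>)
  also have "circle_mean r (\<lambda>\<zeta>. \<Sum>n. ?u n \<zeta>) = circle_mean r (\<lambda>\<zeta>. f \<zeta> * cnj \<zeta> ^ m)"
  proof (rule circle_mean_cong)
    fix \<zeta> assume "cmod \<zeta> = r"
    then have "(\<lambda>n. a n * \<zeta> ^ n * cnj \<zeta> ^ m) sums (f \<zeta> * cnj \<zeta> ^ m)"
      using sums r by (intro sums_mult2) auto
    then show "(\<Sum>n. ?u n \<zeta>) = f \<zeta> * cnj \<zeta> ^ m"
      by (simp add: sums_iff mult.assoc)
  qed (use r in simp)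
  also have "(\<lambda>n. circle_mean r (?u n)) = (\<lambda>n. if n = m then a m * of_real (r ^ (2 * m)) else 0)"
  proof
    fix n
    have "circle_mean r (?u n) = a n * circle_mean r (\<lambda>\<zeta>. \<zeta> ^ n * cnj \<zeta> ^ m)"
      using r by (intro circle_mean_linear[OF bounded_linear_mult_right] continuous_intros) auto
    then show "circle_mean r (?u n) = (if n = m then a m * of_real (r ^ (2 * m)) else 0)"
      using circle_mean_power_cnj_power[OF r(1), of n m] by simp
  qed
  finally show ?thesis
    using sums_unique2 sums_single[of m "\<lambda>_. a m * of_real (r ^ (2 * m))"] by blast
qed

text \<open>Only the conjugate factor is expanded into its series; the terms against the unexpanded
  \<open>f\<close> are given by \<open>circle_mean_coeff\<close>, so no double series
  arises.\<close>

lemma parseval: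
  assumes r: "0 < r" "r < 1"
  shows "(\<lambda>m. (cmod (a m))\<^sup>2 * r ^ (2 * m)) sums circle_mean r (\<lambda>\<zeta>. (cmod (f \<zeta>))\<^sup>2)"
proof -
  have cf: "continuous_on (sphere 0 r) f" using r by (intro continuous_on_circle)
  have "bounded (f ` sphere 0 r)"
    using compact_continuous_image[OF cf compact_sphere] by (rule compact_imp_bounded)
  then obtain A where A: "\<And>\<zeta>. cmod \<zeta> = r \<Longrightarrow> cmod (f \<zeta>) \<le> A"
    unfolding bounded_iff by (metis imageI mem_sphere_0)
  let ?u = "\<lambda>m \<zeta>. cnj (a m) * (f \<zeta> * cnj \<zeta> ^ m)"
  have "(\<lambda>m. circle_mean r (?u m)) sums circle_mean r (\<lambda>\<zeta>. \<Sum>m. ?u m \<zeta>)"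
  proof (rule circle_mean_sums)
    show "norm (?u m \<zeta>) \<le> (cmod (a m) * r ^ m) * A" if "cmod \<zeta> = r" for m \<zeta>
      using mult_left_mono[OF A[OF that], of "cmod (a m) * r ^ m"] that r
      by (simp add: norm_mult norm_power mult_ac)
    show "summable (\<lambda>m. (cmod (a m) * r ^ m) * A)"
      using summable_norm r by (intro summable_mult2) auto
  qed (use r cf in \<open>auto intro!: continuous_intros\<close>)
  also have "circle_mean r (\<lambda>\<zeta>. \<Sum>m. ?u m \<zeta>) = circle_mean r (\<lambda>\<zeta>. of_real ((cmod (f \<zeta>))\<^sup>2))"
  proof (rule circle_mean_cong)
    fix \<zeta> assume "cmod \<zeta> = r"
    then have "(\<lambda>m. cnj (a m * \<zeta> ^ m)) sums cnj (f \<zeta>)"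
      using sums r by (subst sums_cnj) auto
    then have "(\<lambda>m. f \<zeta> * cnj (a m * \<zeta> ^ m)) sums (f \<zeta> * cnj (f \<zeta>))" by (rule sums_mult)
    then show "(\<Sum>m. ?u m \<zeta>) = of_real ((cmod (f \<zeta>))\<^sup>2)"
      by (simp add: sums_iff mult_ac complex_norm_square flip: of_real_power)
  qed (use r in simp)
  also have "\<dots> = of_real (circle_mean r (\<lambda>\<zeta>. (cmod (f \<zeta>))\<^sup>2))"
    using r cf by (intro circle_mean_linear bounded_linear_of_real continuous_intros) auto
  also have "(\<lambda>m. circle_mean r (?u m)) = (\<lambda>m. of_real ((cmod (a m))\<^sup>2 * r ^ (2 * m)))"
  proof
    fix m
    have "circle_mean r (?u m) = cnj (a m) * circle_mean r (\<lambda>\<zeta>. f \<zeta> * cnj \<zeta> ^ m)"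
      using r cf by (intro circle_mean_linear[OF bounded_linear_mult_right] continuous_intros) auto
    then show "circle_mean r (?u m) = of_real ((cmod (a m))\<^sup>2 * r ^ (2 * m))"
      unfolding circle_mean_coeff[OF r] of_real_mult complex_norm_square by (simp add: mult_ac)
  qed
  finally show ?thesis by (simp only: sums_of_real_iff)
qed

end

section \<open>Images of monomials in H^2 and bounds for Taylor coefficients\<close>

lemma holomorphic_imp_disk_power_series:
  assumes "f holomorphic_on ball 0 1"
  shows "disk_power_series (\<lambda>n. (deriv ^^ n) f 0 / fact n) f"
  using holomorphic_power_series[OF assms] by unfold_locales simp

lemma tendsto_at_left_power: "((\<lambda>r::real. c * r ^ n) \<longlongrightarrow> c) (at_left 1)"
  by (rule tendsto_eq_intros | simp)+

text \<open>Volterra images are recognised by their derivative and their value at 0, which avoids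
  manipulating contour integrals.\<close>

lemma eq_on_disk_if_derivative_eq:
  fixes h k :: "complex \<Rightarrow> complex"
  assumes "\<And>z. cmod z < 1 \<Longrightarrow> (h has_field_derivative d z) (at z)"
    and "\<And>z. cmod z < 1 \<Longrightarrow> (k has_field_derivative d z) (at z)"
    and "h 0 = k 0" and z: "cmod z < 1"
  shows "h z = k z"
proof -
  have "((\<lambda>z. h z - k z) has_field_derivative 0) (at w within ball 0 1)" if "w \<in> ball 0 1" for w
  proof -
    have "((\<lambda>z. h z - k z) has_field_derivative d w - d w) (at w)"
      using assms(1,2)[of w] that by (intro DERIV_diff) auto
    then show ?thesis by (simp add: has_field_derivative_at_within)
  qed
  then obtain c where c: "\<forall>w\<in>ball 0 1. h w - k w = c"
    using has_field_derivative_zero_constant[OF convex_ball] by blast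
  have "h z - k z = h 0 - k 0" using c[THEN bspec, of z] c[THEN bspec, of 0] z by simp
  then show ?thesis using assms(3) by simp
qed

text \<open>Integrating z^n g' term by term multiplies the coefficient b_k by k / (k + n) and shifts
  it to degree k + n. Parseval then gives a bound free of \<open>r\<close>, whose terms tend to 0
  with \<open>n\<close> and are dominated by |b_k|^2.\<close>

lemma volterra_monomial_norm2:
  assumes g: "disk_power_series b g" and h: "\<And>z. cmod z < 1 \<Longrightarrow> (h has_field_derivative z ^ n * deriv g z) (at z)"
    and h0: "h 0 = 0" and b: "summable (\<lambda>k. (cmod (b k))\<^sup>2)" and r: "0 < r" "r < 1"
  shows "circle_mean r (\<lambda>\<zeta>. (cmod (h \<zeta>))\<^sup>2) \<le> (\<Sum>k. (cmod (b k))\<^sup>2 * (real k / real (k + n))\<^sup>2)"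
proof -
  interpret g: disk_power_series b g by fact
  \<comment> \<open>For \<open>n = 0\<close> the constant coefficient contains \<open>0 / 0\<close>,
    which is 0; so the series vanishes at the origin for every \<open>n\<close>, as a Volterra image
    must.\<close>
  define c where "c = (\<lambda>m. if m < n then 0 else b (m - n) * of_real (real (m - n) / real m))"
  have c_shift: "c (k + n) = b k * of_real (real k / real (k + n))" for k
    by (simp add: c_def)
  have [simp]: "cmod (of_nat k + of_nat n) = real k + real n" for k
    by (metis norm_of_nat of_nat_add)
  have frac: "0 \<le> real k / real (k + n)" "real k / real (k + n) \<le> 1" for k
    by (auto simp: divide_le_eq_1)
  have summ: "summable (\<lambda>m. c m * z ^ m)" if z: "cmod z < 1" for z
  proof -
    have "summable (\<lambda>k. c (k + n) * z ^ (k + n))"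
    proof (rule summable_comparison_test')
      show "summable (\<lambda>k. cmod (b k) * cmod z ^ k * cmod z ^ n)"
        using z by (intro summable_mult2 g.summable_norm) auto
      show "norm (c (k + n) * z ^ (k + n)) \<le> cmod (b k) * cmod z ^ k * cmod z ^ n" for k
        using mult_left_mono[OF frac(2)[of k], of "cmod (b k) * cmod z ^ k * cmod z ^ n"]
        by (simp add: c_shift norm_mult norm_power norm_divide power_add mult_ac)
    qed
    then show ?thesis by (rule summable_iff_shift[of "\<lambda>m. c m * z ^ m" n, THEN iffD1])
  qed
  define P where "P = (\<lambda>z. \<Sum>m. c m * z ^ m)"
  have P0: "P 0 = 0"
    using powser_sums_zero[of c] by (auto simp: P_def sums_iff c_def)
  have dg: "(\<lambda>k. diffs b k * z ^ k) sums deriv g z" if z: "cmod z < 1" for z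
  proof -
    have s: "summable (\<lambda>k. b k * w ^ k)" if "cmod w < 1" for w using g.sums[OF that] sums_summable by blast
    have "((\<lambda>z. \<Sum>k. b k * z ^ k) has_field_derivative (\<Sum>k. diffs b k * z ^ k)) (at z)"
      by (rule termdiffs_strong'[OF s z])
    then have "(g has_field_derivative (\<Sum>k. diffs b k * z ^ k)) (at z)"
      by (rule has_field_derivative_transform_within_open[where S = "ball 0 1"])
         (use z g.sums in \<open>auto simp: sums_iff\<close>)
    then show ?thesis
      using DERIV_imp_deriv termdiff_converges[OF z s] by (metis summable_sums)
  qed
  have dP: "(P has_field_derivative z ^ n * deriv g z) (at z)" if z: "cmod z < 1" for z
  proof -
    have "(\<lambda>k. diffs c (k + n) * z ^ (k + n)) = (\<lambda>k. z ^ n * (diffs b k * z ^ k))"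
    proof
      fix k
      have "diffs c (k + n) = diffs b k"
        using c_shift[of "Suc k"] by (simp add: diffs_def field_simps del: of_nat_Suc)
      then show "diffs c (k + n) * z ^ (k + n) = z ^ n * (diffs b k * z ^ k)"
        by (simp add: power_add mult_ac)
    qed
    then have "(\<lambda>k. diffs c (k + n) * z ^ (k + n)) sums (z ^ n * deriv g z)"
      using sums_mult[OF dg[OF z], of "z ^ n"] by simp
    moreover have "diffs c m = 0" if "m < n" for m
      using that by (auto simp: diffs_def c_def)
    ultimately have "(\<lambda>m. diffs c m * z ^ m) sums (z ^ n * deriv g z)"
      by (subst (asm) sums_zero_iff_shift) auto
    then show ?thesis
      using termdiffs_strong'[OF summ z] by (simp add: P_def sums_iff)
  qed
  have hP: "h z = P z" if z: "cmod z < 1" for z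
    by (rule eq_on_disk_if_derivative_eq[OF h dP _ z]) (simp_all add: h0 P0)
  interpret h: disk_power_series c h
    by unfold_locales (use summ hP in \<open>simp add: P_def summable_sums\<close>)
  have "(\<lambda>k. (cmod (c (k + n)))\<^sup>2 * r ^ (2 * (k + n))) sums circle_mean r (\<lambda>\<zeta>. (cmod (h \<zeta>))\<^sup>2)"
    using h.parseval[OF r] by (subst sums_zero_iff_shift) (auto simp: c_def)
  moreover have "(\<lambda>k. (cmod (b k))\<^sup>2 * (real k / real (k + n))\<^sup>2) sums (\<Sum>k. (cmod (b k))\<^sup>2 * (real k / real (k + n))\<^sup>2)"
    using frac by (intro summable_sums summable_comparison_test'[OF b])
      (auto intro!: mult_left_le power_le_one simp: abs_mult simp del: of_nat_add)
  ultimately show ?thesis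
  proof (rule sums_le[rotated])
    fix k
    have "(cmod (c (k + n)))\<^sup>2 = (cmod (b k))\<^sup>2 * (real k / real (k + n))\<^sup>2"
      by (simp add: c_shift norm_mult norm_divide power_mult_distrib power_divide)
    moreover have "r ^ (2 * (k + n)) \<le> 1" using r by (intro power_le_one) auto
    ultimately show "(cmod (c (k + n)))\<^sup>2 * r ^ (2 * (k + n)) \<le> (cmod (b k))\<^sup>2 * (real k / real (k + n))\<^sup>2"
      by (metis mult_left_le zero_le_power2 zero_le_mult_iff)
  qed
qed

lemma suminf_weighted_ratio_tendsto_0:
  assumes "summable (\<lambda>k. \<beta> k)" "\<And>k. 0 \<le> \<beta> k"
  shows "(\<lambda>n. \<Sum>k. \<beta> k * (real k / real (k + n))\<^sup>2) \<longlonglongrightarrow> 0"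
proof -
  have "(\<lambda>n. \<Sum>k. \<beta> k * (real k / real (k + n))\<^sup>2) \<longlonglongrightarrow> (\<Sum>k. 0 :: real)"
  proof (rule tannerys_theorem[THEN conjunct2, THEN conjunct2, OF _ _ assms(1)])
    show "(\<lambda>n. \<beta> k * (real k / real (k + n))\<^sup>2) \<longlonglongrightarrow> 0" for k
    proof -
      have "(\<lambda>n. real k / real (n + k)) \<longlonglongrightarrow> 0"
        by (rule LIMSEQ_ignore_initial_segment[OF lim_const_over_n])
      then have "(\<lambda>n. \<beta> k * (real k / real (n + k))\<^sup>2) \<longlonglongrightarrow> \<beta> k * 0\<^sup>2" by (intro tendsto_intros)
      then show ?thesis by (simp add: add.commute)
    qed
    have "norm (\<beta> k * (real k / real (k + n))\<^sup>2) \<le> \<beta> k" for k n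
      using assms(2)[of k] by (auto simp: abs_mult divide_le_eq_1 intro!: mult_left_le power_le_one simp del: of_nat_add)
    then show "\<forall>\<^sub>F (k, n) in at_top \<times>\<^sub>F sequentially. norm (\<beta> k * (real k / real (k + n))\<^sup>2) \<le> \<beta> k"
      by (intro always_eventually) auto
  qed auto
  then show ?thesis by simp
qed

text \<open>Finitely many terms of Parseval's identity stay below \<open>A\<close>, and in a finite
  sum \<open>r\<close> may tend to 1.\<close>

lemma summable_coeff_norm2:
  assumes g: "disk_power_series b g" and A: "\<And>r. 0 < r \<Longrightarrow> r < 1 \<Longrightarrow> circle_mean r (\<lambda>\<zeta>. (cmod (g \<zeta>))\<^sup>2) \<le> A"
  shows "summable (\<lambda>k. (cmod (b k))\<^sup>2)"
proof (rule summableI_nonneg_bounded)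
  fix n
  have "((\<lambda>r. \<Sum>k<n. (cmod (b k))\<^sup>2 * r ^ (2 * k)) \<longlongrightarrow> (\<Sum>k<n. (cmod (b k))\<^sup>2)) (at_left 1)"
    by (intro tendsto_sum tendsto_at_left_power)
  moreover have "\<forall>\<^sub>F r in at_left 1. (\<Sum>k<n. (cmod (b k))\<^sup>2 * r ^ (2 * k)) \<le> A"
  proof -
    have "(\<Sum>k<n. (cmod (b k))\<^sup>2 * r ^ (2 * k)) \<le> A" if r: "0 < r" "r < 1" for r
      using disk_power_series.parseval[OF g r] A[OF r] r
      by (intro order_trans[OF sum_le_suminf]) (auto simp: sums_iff)
    then show ?thesis using eventually_at_left_real[of 0 1] by (auto elim!: eventually_mono)
  qed
  ultimately show "(\<Sum>k<n. (cmod (b k))\<^sup>2) \<le> A"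
    by (rule tendsto_upperbound) simp
qed simp

text \<open>The coefficient is a mean of \<open>f\<close> against a conjugate power. The pointwise
  bound x \<le> 1 + x^p takes the place of Hoelder's inequality, at the price of
  \<open>1 + A\<close>; afterwards \<open>r\<close> tends to 1.\<close>

lemma coeff_bounded:
  assumes f: "disk_power_series a f" and p: "1 \<le> p"
    and A: "\<And>r. 0 < r \<Longrightarrow> r < 1 \<Longrightarrow> circle_mean r (\<lambda>\<zeta>. cmod (f \<zeta>) powr p) \<le> A"
  shows "cmod (a m) \<le> 1 + A"
proof -
  interpret f: disk_power_series a f by fact
  have "cmod (a m) * r ^ m \<le> 1 + A" if r: "0 < r" "r < 1" for r
  proof -
    have c: "continuous_on (sphere 0 r) f" using r by (intro f.continuous_on_circle)
    have cp: "continuous_on (sphere 0 r) (\<lambda>\<zeta>. cmod (f \<zeta>) powr p)"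
      using p c by (intro continuous_on_powr' continuous_intros) auto
    have "cmod (a m) * r ^ m * r ^ m = cmod (circle_mean r (\<lambda>\<zeta>. f \<zeta> * cnj \<zeta> ^ m))"
      using r by (simp add: f.circle_mean_coeff norm_mult norm_power mult_2 power_add)
    also have "\<dots> \<le> circle_mean r (\<lambda>\<zeta>. cmod (f \<zeta> * cnj \<zeta> ^ m))"
      using r c by (intro circle_mean_norm_le continuous_intros) auto
    also have "\<dots> = circle_mean r (\<lambda>\<zeta>. r ^ m * cmod (f \<zeta>))"
      using r by (intro circle_mean_cong) (auto simp: norm_mult norm_power)
    also have "\<dots> = r ^ m * circle_mean r (\<lambda>\<zeta>. cmod (f \<zeta>))" by simp
    also have "circle_mean r (\<lambda>\<zeta>. cmod (f \<zeta>)) \<le> circle_mean r (\<lambda>\<zeta>. 1 + cmod (f \<zeta>) powr p)"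
    proof (rule circle_mean_mono)
      fix \<zeta>
      show "cmod (f \<zeta>) \<le> 1 + cmod (f \<zeta>) powr p"
      proof (cases "cmod (f \<zeta>) \<le> 1")
        case False
        then have "cmod (f \<zeta>) powr 1 \<le> cmod (f \<zeta>) powr p" using p by (intro powr_mono) auto
        then show ?thesis using False by simp
      qed (simp add: add_increasing2)
    qed (use r c cp in \<open>auto intro!: continuous_intros\<close>)
    also have "\<dots> = 1 + circle_mean r (\<lambda>\<zeta>. cmod (f \<zeta>) powr p)"
      using r cp by (subst circle_mean_add) auto
    also have "\<dots> \<le> 1 + A" using A[OF r] by simp
    finally have "cmod (a m) * r ^ m * r ^ m \<le> (1 + A) * r ^ m"
      using r by (simp add: mult.commute mult_left_mono)
    then show ?thesis using r by simp
  qed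
  then have "\<forall>\<^sub>F r in at_left 1. cmod (a m) * r ^ m \<le> 1 + A"
    using eventually_at_left_real[of 0 1] by (auto elim!: eventually_mono)
  with tendsto_at_left_power show ?thesis by (rule tendsto_upperbound) simp
qed

section \<open>The Volterra operator on monomials and lacunary series\<close>

lemma volterra_0 [simp]: "volterra g f 0 = 0"
  by (simp add: volterra_def contour_integral_trivial)

lemma volterra_has_field_derivative:
  assumes f: "f holomorphic_on ball 0 1" and g: "g holomorphic_on ball 0 1" and z: "cmod z < 1"
  shows "(volterra g f has_field_derivative f z * deriv g z) (at z)"
proof -
  have "(\<lambda>z. f z * deriv g z) holomorphic_on ball 0 1"
    using f g by (intro holomorphic_intros holomorphic_deriv) auto
  then obtain P where P: "\<And>x. x \<in> ball 0 1 \<Longrightarrow> (P has_field_derivative f x * deriv g x) (at x within ball 0 1)"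
    using holomorphic_convex_primitive'[OF convex_ball open_ball] by blast
  have eq: "P w - P 0 = volterra g f w" if "w \<in> ball 0 1" for w
  proof -
    have "path_image (linepath 0 w) \<subseteq> ball 0 1"
      using that closed_segment_subset[of 0 "ball 0 1" w] by simp
    then show ?thesis
      using contour_integral_primitive[OF P valid_path_linepath, of 0 w]
      by (simp add: volterra_def contour_integral_unique)
  qed
  have "(P has_field_derivative f z * deriv g z) (at z)"
    using P[of z] z at_within_open[of z "ball 0 1"] by simp
  then have "((\<lambda>w. P w - P 0) has_field_derivative f z * deriv g z) (at z)"
    using DERIV_diff[OF _ DERIV_const] by fastforce
  then show ?thesis
    by (rule has_field_derivative_transform_within_open[where S = "ball 0 1"]) (use z eq in simp_all)
qed

lemma volterra_holomorphic:
  "f holomorphic_on ball 0 1 \<Longrightarrow> g holomorphic_on ball 0 1 \<Longrightarrow> volterra g f holomorphic_on ball 0 1"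
  unfolding holomorphic_on_open[OF open_ball, of "volterra g f"]
  using volterra_has_field_derivative mem_ball_0 by blast

lemma continuous_on_circle_norm_powr:
  assumes "f holomorphic_on ball 0 1" "r < 1" "0 < p"
  shows "continuous_on (sphere 0 r) (\<lambda>z. cmod (f z) powr p)"
  using holomorphic_on_imp_continuous_on[OF assms(1)] assms(2,3)
  by (intro continuous_on_powr' continuous_intros) (auto elim!: continuous_on_subset)

text \<open>Values with x^p at most \<eta> or at least 1 / \<eta> are covered by \<eta> (1 +
  x^(2p)). In between, x^2 exceeds \<eta>^(2/p) while x^p stays below 1 / \<eta>, which is where the
  constant in front of x^2 comes from.\<close>

lemma powr_le_interpolation:
  fixes x \<eta> p :: real
  assumes "0 \<le> x" "0 < \<eta>" "0 < p"
  shows "x powr p \<le> \<eta> * (1 + x powr (2 * p)) + 1 / (\<eta> * \<eta> powr (2 / p)) * x\<^sup>2"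
proof -
  consider "x powr p \<le> \<eta>" | "1 / \<eta> \<le> x powr p" | "\<eta> < x powr p" "x powr p < 1 / \<eta>" by linarith
  then show ?thesis
  proof cases
    case 1
    then show ?thesis using assms by (simp add: distrib_left add_increasing2)
  next
    case 2
    then have "1 * x powr p \<le> (\<eta> * x powr p) * x powr p"
      using assms by (intro mult_right_mono) (auto simp: field_simps)
    also have "\<dots> = \<eta> * x powr (2 * p)"
      unfolding mult_2 powr_add by (rule mult.assoc)
    finally show ?thesis using assms by (simp add: distrib_left add_increasing add_increasing2)
  next
    case 3
    then have x: "0 < x" using assms by (cases "x = 0") auto
    have "\<eta> powr (2 / p) \<le> (x powr p) powr (2 / p)"
      using 3 assms by (intro powr_mono2) auto
    also have "\<dots> = x\<^sup>2" using x assms by (simp add: powr_powr)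
    finally have "1 / \<eta> * 1 \<le> 1 / \<eta> * (x\<^sup>2 / \<eta> powr (2 / p))"
      using assms by (intro mult_left_mono) auto
    then have "x powr p \<le> 1 / (\<eta> * \<eta> powr (2 / p)) * x\<^sup>2" using 3 by simp
    then show ?thesis using assms by (simp add: add_increasing)
  qed
qed

lemma circle_mean_norm_powr_le_interpolation:
  assumes h: "h holomorphic_on ball 0 1" and r: "0 < r" "r < 1" and p: "0 < p" and \<eta>: "0 < \<eta>"
  shows "circle_mean r (\<lambda>z. cmod (h z) powr p) \<le> \<eta> * (1 + circle_mean r (\<lambda>z. cmod (h z) powr (2 * p)))
     + 1 / (\<eta> * \<eta> powr (2 / p)) * circle_mean r (\<lambda>z. (cmod (h z))\<^sup>2)"
proof -
  note c = continuous_on_circle_norm_powr[OF h r(2)]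
  have c2: "continuous_on (sphere 0 r) (\<lambda>z. (cmod (h z))\<^sup>2)"
    using holomorphic_on_imp_continuous_on[OF h] r(2)
    by (intro continuous_intros) (auto elim!: continuous_on_subset)
  have p2: "0 < 2 * p" using p by simp
  have "circle_mean r (\<lambda>z. cmod (h z) powr p) \<le> circle_mean r (\<lambda>z. \<eta> * (1 + cmod (h z) powr (2 * p))
      + 1 / (\<eta> * \<eta> powr (2 / p)) * (cmod (h z))\<^sup>2)"
    using r p \<eta> c[OF p] c[OF p2] c2
    by (intro circle_mean_mono powr_le_interpolation continuous_on_add continuous_on_mult_left continuous_on_const) auto
  also have "\<dots> = circle_mean r (\<lambda>z. \<eta> * (1 + cmod (h z) powr (2 * p)))
      + circle_mean r (\<lambda>z. 1 / (\<eta> * \<eta> powr (2 / p)) * (cmod (h z))\<^sup>2)"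
    using r c[OF p2] c2
    by (intro circle_mean_add continuous_on_add continuous_on_mult_left continuous_on_const) auto
  also have "circle_mean r (\<lambda>z. 1 / (\<eta> * \<eta> powr (2 / p)) * (cmod (h z))\<^sup>2)
      = 1 / (\<eta> * \<eta> powr (2 / p)) * circle_mean r (\<lambda>z. (cmod (h z))\<^sup>2)"
    by (rule circle_mean_cmult)
  also have "circle_mean r (\<lambda>z. \<eta> * (1 + cmod (h z) powr (2 * p)))
      = \<eta> * (1 + circle_mean r (\<lambda>z. cmod (h z) powr (2 * p)))"
    using r c[OF p2] unfolding circle_mean_cmult by (subst circle_mean_add) auto
  finally show ?thesis .
qed

text \<open>A pointwise substitute for Minkowski's inequality: every |v_k| is at most 2^(-k-1) times
  the \<open>p\<close>-th root of the right-hand side, and these weights sum to at most 1.\<close>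

lemma norm_sum_powr_le:
  fixes v :: "nat \<Rightarrow> complex"
  assumes p: "1 \<le> p"
  shows "cmod (\<Sum>k<N. v k) powr p \<le> (\<Sum>k<N. (2 ^ Suc k * cmod (v k)) powr p)"
proof -
  define Z where "Z = (\<Sum>k<N. (2 ^ Suc k * cmod (v k)) powr p)"
  have Z0: "0 \<le> Z" by (auto simp: Z_def intro: sum_nonneg)
  have geo: "(\<Sum>k<N. (1 / 2 :: real) ^ Suc k) \<le> 1"
  proof -
    have "(\<Sum>k<N. (1 / 2 :: real) ^ Suc k) = 1 - (1 / 2) ^ N"
      by (induction N) (auto simp: field_simps)
    then show ?thesis by simp
  qed
  have le: "cmod (v k) \<le> Z powr (1 / p) * (1 / 2) ^ Suc k" if "k < N" for k
  proof -
    have "(2 ^ Suc k * cmod (v k)) powr p \<le> Z"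
      unfolding Z_def using that by (intro member_le_sum) auto
    then have "((2 ^ Suc k * cmod (v k)) powr p) powr (1 / p) \<le> Z powr (1 / p)"
      using p by (intro powr_mono2) auto
    then have "2 ^ Suc k * cmod (v k) \<le> Z powr (1 / p)"
      using p by (simp add: powr_powr)
    then show ?thesis by (simp add: field_simps)
  qed
  have "cmod (\<Sum>k<N. v k) \<le> (\<Sum>k<N. cmod (v k))" by (rule norm_sum)
  also have "\<dots> \<le> (\<Sum>k<N. Z powr (1 / p) * (1 / 2) ^ Suc k)" using le by (intro sum_mono) auto
  also have "\<dots> = Z powr (1 / p) * (\<Sum>k<N. (1 / 2) ^ Suc k)" by (rule sum_distrib_left[symmetric])
  also have "\<dots> \<le> Z powr (1 / p)" using geo by (intro mult_left_le) auto
  finally have "cmod (\<Sum>k<N. v k) powr p \<le> (Z powr (1 / p)) powr p"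
    using p by (intro powr_mono2) auto
  also have "\<dots> = Z" using p Z0 by (simp add: powr_powr)
  finally show ?thesis by (simp add: Z_def)
qed

lemma circle_mean_sum:
  fixes u :: "'b \<Rightarrow> complex \<Rightarrow> 'a::banach"
  assumes "finite A" "\<And>k. k \<in> A \<Longrightarrow> continuous_on (sphere 0 r) (u k)" "0 \<le> r"
  shows "circle_mean r (\<lambda>z. \<Sum>k\<in>A. u k z) = (\<Sum>k\<in>A. circle_mean r (u k))"
  using assms by (induction A rule: finite_induct) (auto simp: circle_mean_add continuous_on_sum)

text \<open>A lacunary series \<open>\<Sum> (k + 1) z\<^bsup>\<nu>\<^sub>k\<^esup>\<close> has unbounded coefficients; if \<open>T\<^sub>g z\<^sup>n\<close> tends to 0
  in \<open>H\<^sup>p\<close>, sparse exponents make its image under \<open>T\<^sub>g\<close> converge in \<open>H\<^sup>p\<close>.\<close>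

lemma exists_unbounded_coeffs_volterra_bounded:
  fixes p :: real
  assumes p: "1 \<le> p" and g: "g holomorphic_on ball 0 1"
    and small: "\<And>\<eta>. 0 < \<eta> \<Longrightarrow> \<exists>N. \<forall>n\<ge>N. \<forall>r. 0 < r \<longrightarrow> r < 1 \<longrightarrow>
      circle_mean r (\<lambda>z. cmod (volterra g (\<lambda>z. z ^ n) z) powr p) \<le> \<eta>"
  obtains a f where "disk_power_series a f" "\<And>A. \<exists>m. A < cmod (a m)"
    "\<And>r. 0 < r \<Longrightarrow> r < 1 \<Longrightarrow> circle_mean r (\<lambda>z. cmod (volterra g f z) powr p) \<le> 2 * 2 powr p"
proof -
  \<comment> \<open>Collects the coefficient k + 1 of the series and the weight 2^(k+1) of
    \<open>norm_sum_powr_le\<close>, so that the tolerance in \<open>N\<close> below makes the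
    weighted means sum to at most 1.\<close>
  define w where "w = (\<lambda>k. 2 ^ Suc k * real (Suc k))"
  have w: "0 < w k" for k by (simp add: w_def)
  have "\<forall>k. \<exists>N. \<forall>n\<ge>N. \<forall>r. 0 < r \<longrightarrow> r < 1 \<longrightarrow>
      circle_mean r (\<lambda>z. cmod (volterra g (\<lambda>z. z ^ n) z) powr p) \<le> (1 / 2) ^ Suc k / w k powr p"
    using small w by (simp add: less_imp_neq[symmetric])
  then obtain N where N: "\<And>k n r. N k \<le> n \<Longrightarrow> 0 < r \<Longrightarrow> r < 1 \<Longrightarrow>
      circle_mean r (\<lambda>z. cmod (volterra g (\<lambda>z. z ^ n) z) powr p) \<le> (1 / 2) ^ Suc k / w k powr p"
    by metis
  \<comment> \<open>The sum makes \<nu> k at least \<open>N k\<close>; the summand \<open>k\<close>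
    makes \<nu> strictly increasing with \<nu> k \<ge> k, which gives convergence on the
    disk.\<close>
  define \<nu> where "\<nu> = (\<lambda>k. k + (\<Sum>j\<le>k. N j))"
  have \<nu>: "strict_mono \<nu>" by (simp add: strict_mono_Suc_iff \<nu>_def)
  have \<nu>k: "N k \<le> \<nu> k" "k \<le> \<nu> k" for k
    by (auto simp: \<nu>_def intro!: trans_le_add2 member_le_sum)
  define a :: "nat \<Rightarrow> complex" where "a = (\<lambda>m. if m \<in> range \<nu> then of_nat (Suc (inv \<nu> m)) else 0)"
  have a\<nu>: "a (\<nu> k) = of_nat (Suc k)" for k
    using strict_mono_imp_inj_on[OF \<nu>] by (simp add: a_def)
  let ?f = "\<lambda>z::complex. \<Sum>k. of_nat (Suc k) * z ^ \<nu> k"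
  have bd: "cmod (of_nat (Suc k) * z ^ \<nu> k) \<le> of_nat (Suc k) * \<rho> ^ k" if "cmod z \<le> \<rho>" "\<rho> < 1" for z :: complex and \<rho> k
  proof -
    have \<rho>: "0 \<le> \<rho>" using that norm_ge_zero[of z] by linarith
    have "cmod z ^ \<nu> k \<le> \<rho> ^ \<nu> k" using that by (intro power_mono) auto
    also have "\<dots> \<le> \<rho> ^ k" using that \<rho> \<nu>k(2) by (intro power_decreasing) auto
    finally show ?thesis unfolding norm_mult norm_power norm_of_nat by (intro mult_left_mono) auto
  qed
  have sm: "summable (\<lambda>k. of_nat (Suc k) * \<rho> ^ k)" if "0 \<le> \<rho>" "\<rho> < 1" for \<rho> :: real
    using geometric_deriv_sums[of \<rho>] that by (simp add: sums_iff)
  have f: "disk_power_series a ?f"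
  proof
    fix z :: complex assume z: "cmod z < 1"
    have "summable (\<lambda>k. of_nat (Suc k) * z ^ \<nu> k)"
      by (rule summable_comparison_test'[OF sm[of "cmod z"]]) (use z bd in auto)
    then have "(\<lambda>k. a (\<nu> k) * z ^ \<nu> k) sums ?f z"
      unfolding a\<nu> by (rule summable_sums)
    then show "(\<lambda>n. a n * z ^ n) sums ?f z"
      by (subst (asm) sums_mono_reindex[OF \<nu>, of "\<lambda>n. a n * z ^ n"]) (auto simp: a_def)
  qed
  note fhol = disk_power_series.holomorphic[OF f]
  show thesis
  proof (rule that[OF f])
    show "\<exists>m. A < cmod (a m)" for A
    proof -
      obtain k where "A < real k" using reals_Archimedean2 by blast
      then have "A < cmod (a (\<nu> k))" unfolding a\<nu> norm_of_nat by simp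
      then show ?thesis ..
    qed
    fix r :: real assume r: "0 < r" "r < 1"
    let ?h = "volterra g ?f" and ?H = "\<lambda>k. volterra g (\<lambda>z. z ^ \<nu> k)"
    have hH: "?H k holomorphic_on ball 0 1" for k by (intro volterra_holomorphic g holomorphic_intros)
    have "deriv g holomorphic_on ball 0 1" using g by (intro holomorphic_deriv) auto
    then have "continuous_on (cball 0 r) (deriv g)"
      using r by (auto intro: continuous_on_subset dest!: holomorphic_on_imp_continuous_on)
    then have "bounded (deriv g ` cball 0 r)"
      using compact_continuous_image compact_imp_bounded compact_cball by blast
    then obtain G where G: "0 < G" "\<And>z. cmod z \<le> r \<Longrightarrow> cmod (deriv g z) \<le> G"
      unfolding bounded_pos by (metis imageI mem_cball_0)
    \<comment> \<open>The truncation index obtained from this depends on \<open>r\<close>. That is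
      harmless, since the final bound contains neither.\<close>
    have "uniform_limit (cball 0 r) (\<lambda>n z. \<Sum>k<n. of_nat (Suc k) * z ^ \<nu> k) ?f sequentially"
      by (rule Weierstrass_m_test[of _ "\<lambda>k z. of_nat (Suc k) * z ^ \<nu> k" "\<lambda>k. of_nat (Suc k) * r ^ k"])
         (use bd r sm[of r] in auto)
    then have "\<forall>\<^sub>F n in sequentially. \<forall>z\<in>cball 0 r. dist (\<Sum>k<n. of_nat (Suc k) * z ^ \<nu> k) (?f z) < 1 / G"
      using G(1) by (simp add: uniform_limit_iff)
    then obtain n where n: "\<And>z. cmod z \<le> r \<Longrightarrow> cmod (?f z - (\<Sum>k<n. of_nat (Suc k) * z ^ \<nu> k)) \<le> 1 / G"
      unfolding eventually_sequentially dist_norm by (metis less_imp_le mem_cball_0 norm_minus_commute order_refl)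
    \<comment> \<open>The Volterra image of the tail. Its derivative is the tail times g', at most
      (1 / G) * G = 1, and it vanishes at 0; hence it is bounded by 1 on the disk of radius
      \<open>r\<close>.\<close>
    define D where "D = (\<lambda>z. ?h z - (\<Sum>k<n. of_nat (Suc k) * ?H k z))"
    have D1: "cmod (D z) \<le> 1" if z: "cmod z \<le> r" for z
    proof -
      have "cmod (D z - D 0) \<le> 1 * cmod (z - 0)"
      proof (rule field_differentiable_bound[of "cball 0 r"])
        fix u :: complex assume "u \<in> cball 0 r"
        then have u: "cmod u \<le> r" "cmod u < 1" using r by auto
        have "(D has_field_derivative ?f u * deriv g u - (\<Sum>k<n. of_nat (Suc k) * (u ^ \<nu> k * deriv g u))) (at u)"
          unfolding D_def
          by (intro DERIV_diff DERIV_sum DERIV_cmult volterra_has_field_derivative fhol g u(2) holomorphic_intros)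
        also have "?f u * deriv g u - (\<Sum>k<n. of_nat (Suc k) * (u ^ \<nu> k * deriv g u))
           = (?f u - (\<Sum>k<n. of_nat (Suc k) * u ^ \<nu> k)) * deriv g u"
          by (simp only: left_diff_distrib sum_distrib_right mult.assoc)
        finally show "(D has_field_derivative (?f u - (\<Sum>k<n. of_nat (Suc k) * u ^ \<nu> k)) * deriv g u) (at u within cball 0 r)"
          by (rule has_field_derivative_at_within)
        show "norm ((?f u - (\<Sum>k<n. of_nat (Suc k) * u ^ \<nu> k)) * deriv g u) \<le> 1"
          using mult_mono[OF n[OF u(1)] G(2)[OF u(1)]] G(1) by (simp add: norm_mult)
      qed (use z r in auto)
      moreover have "D 0 = 0" by (simp add: D_def)
      ultimately show ?thesis using z r by simp
    qed
    have pw: "cmod (?h z) powr p \<le> 2 powr p * ((\<Sum>k<n. w k powr p * cmod (?H k z) powr p) + 1)"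
      if z: "cmod z = r" for z
    proof -
      let ?S = "\<Sum>k<n. of_nat (Suc k) * ?H k z"
      have "cmod (?h z) \<le> cmod ?S + cmod (D z)"
        using norm_triangle_ineq[of ?S "D z"] by (simp add: D_def)
      \<comment> \<open>Taking twice the maximum separates sum and remainder after the
        \<open>p\<close>-th power at the cost of 2^p. Each of the two then contributes at most 1 to
        the mean, which gives \<open>2 * 2 powr p\<close>.\<close>
      then have "cmod (?h z) \<le> 2 * max (cmod ?S) 1" using D1[of z] z by auto
      then have "cmod (?h z) powr p \<le> (2 * max (cmod ?S) 1) powr p"
        using p by (intro powr_mono2) auto
      also have "\<dots> = 2 powr p * (max (cmod ?S) 1) powr p" by (simp add: powr_mult)
      also have "\<dots> \<le> 2 powr p * (cmod ?S powr p + 1)"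
        by (intro mult_left_mono) (auto simp: max_def)
      also have "cmod ?S powr p \<le> (\<Sum>k<n. (2 ^ Suc k * cmod (of_nat (Suc k) * ?H k z)) powr p)"
        by (rule norm_sum_powr_le[OF p])
      also have "\<dots> = (\<Sum>k<n. w k powr p * cmod (?H k z) powr p)"
        using w unfolding w_def norm_mult norm_of_nat by (intro sum.cong) (simp_all add: powr_mult mult.assoc)
      finally show ?thesis by simp
    qed
    have p0: "0 < p" using p by simp
    note c = continuous_on_circle_norm_powr[OF _ r(2) p0]
    have cs: "continuous_on (sphere 0 r) (\<lambda>z. \<Sum>k<n. w k powr p * cmod (?H k z) powr p)"
      using c[OF hH] by (intro continuous_on_sum continuous_on_mult_left)
    have "circle_mean r (\<lambda>z. cmod (?h z) powr p)
        \<le> circle_mean r (\<lambda>z. 2 powr p * ((\<Sum>k<n. w k powr p * cmod (?H k z) powr p) + 1))"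
      using r pw cs c[OF volterra_holomorphic[OF fhol g]]
      by (intro circle_mean_mono continuous_on_add continuous_on_mult_left continuous_on_const) auto
    also have "\<dots> = 2 powr p * ((\<Sum>k<n. w k powr p * circle_mean r (\<lambda>z. cmod (?H k z) powr p)) + 1)"
    proof -
      have "circle_mean r (\<lambda>z. \<Sum>k<n. w k powr p * cmod (?H k z) powr p)
          = (\<Sum>k<n. circle_mean r (\<lambda>z. w k powr p * cmod (?H k z) powr p))"
        using r c[OF hH] by (intro circle_mean_sum continuous_on_mult_left) auto
      then show ?thesis
        using r cs unfolding circle_mean_cmult by (subst circle_mean_add) auto
    qed
    also have "\<dots> \<le> 2 powr p * (1 + 1)"
    proof (intro mult_left_mono add_right_mono)
      have "(\<Sum>k<n. w k powr p * circle_mean r (\<lambda>z. cmod (?H k z) powr p)) \<le> (\<Sum>k<n. (1 / 2) ^ Suc k)"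
      proof (rule sum_mono)
        fix k
        have "w k powr p * circle_mean r (\<lambda>z. cmod (?H k z) powr p) \<le> w k powr p * ((1 / 2) ^ Suc k / w k powr p)"
          using N[OF \<nu>k(1) r] by (intro mult_left_mono) auto
        then show "w k powr p * circle_mean r (\<lambda>z. cmod (?H k z) powr p) \<le> (1 / 2) ^ Suc k"
          using w[of k] by simp
      qed
      also have "\<dots> = 1 - (1 / 2) ^ n" by (induction n) (auto simp: field_simps)
      finally show "(\<Sum>k<n. w k powr p * circle_mean r (\<lambda>z. cmod (?H k z) powr p)) \<le> 1"
        by (rule order_trans) simp
    qed simp
    finally show "circle_mean r (\<lambda>z. cmod (?h z) powr p) \<le> 2 * 2 powr p" by simp
  qed
qed

section \<open>Hardy norms\<close>

lemma integral_mean_eq_circle_mean: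
  "integral_mean p f r = circle_mean r (\<lambda>z. cmod (f z) powr p) powr (1 / p)"
proof -
  have "integral {0..2*pi} (\<lambda>t. u t / (2 * pi)) = integral {0..2*pi} u /\<^sub>R (2 * pi)" for u :: "real \<Rightarrow> real"
    by (simp add: field_simps)
  then show ?thesis by (simp only: integral_mean_def circle_mean_def)
qed

lemma circle_mean_nonneg:
  assumes "continuous_on (sphere 0 r) u" "0 \<le> r" "\<And>z. 0 \<le> u z"
  shows "0 \<le> circle_mean r (u :: complex \<Rightarrow> real)"
  using circle_mean_mono[OF continuous_on_const assms(1,2), of 0] assms(3) by simp

lemma circle_mean_norm_powr_nonneg:
  assumes "f holomorphic_on ball 0 1" "0 \<le> r" "r < 1" "0 < p"
  shows "0 \<le> circle_mean r (\<lambda>z. cmod (f z) powr p)"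
  using assms by (intro circle_mean_nonneg continuous_on_circle_norm_powr) auto

lemma circle_mean_0 [simp]: "circle_mean 0 u = u 0"
  by (simp add: circle_mean_def)

text \<open>The supremum includes \<open>r = 0\<close>, where the mean is |f 0|^p, while the
  available estimates concern positive radii; the hypothesis \<open>f 0 = 0\<close> closes this
  gap.\<close>

lemma hardy_norm_le:
  assumes f: "f holomorphic_on ball 0 1" and p: "0 < p"
    and A: "\<And>r. 0 < r \<Longrightarrow> r < 1 \<Longrightarrow> circle_mean r (\<lambda>z. cmod (f z) powr p) \<le> A"
    and 0: "f 0 = 0"
  shows "hardy_norm p f \<le> ennreal (A powr (1 / p))"
  unfolding hardy_norm_def
proof (rule SUP_least)
  fix r :: real assume r: "r \<in> {0..<1}"
  show "ennreal (integral_mean p f r) \<le> ennreal (A powr (1 / p))"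
  proof (cases "r = 0")
    case True
    then show ?thesis using 0 p by (simp add: integral_mean_eq_circle_mean)
  next
    case False
    then show ?thesis
      unfolding integral_mean_eq_circle_mean using r p A[of r] circle_mean_norm_powr_nonneg[OF f, of r p]
      by (intro ennreal_leI powr_mono2) auto
  qed
qed

lemma circle_mean_le_if_hardy_norm_le:
  assumes f: "f holomorphic_on ball 0 1" and p: "0 < p" and B: "hardy_norm p f \<le> ennreal B" "0 \<le> B"
    and r: "0 \<le> r" "r < 1"
  shows "circle_mean r (\<lambda>z. cmod (f z) powr p) \<le> B powr p"
proof -
  let ?m = "circle_mean r (\<lambda>z. cmod (f z) powr p)"
  have "ennreal (integral_mean p f r) \<le> hardy_norm p f"
    unfolding hardy_norm_def using r by (intro SUP_upper) auto
  also note B(1)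
  finally have "?m powr (1 / p) \<le> B"
    using B(2) by (simp add: integral_mean_eq_circle_mean)
  then have "(?m powr (1 / p)) powr p \<le> B powr p" using p by (intro powr_mono2) auto
  then show ?thesis
    using p circle_mean_norm_powr_nonneg[OF f r p] by (simp add: powr_powr)
qed

lemma hardy_norm_cong:
  assumes "\<And>z. cmod z < 1 \<Longrightarrow> f z = h z"
  shows "hardy_norm p f = hardy_norm p h"
proof -
  have "circle_mean r (\<lambda>z. cmod (f z) powr p) = circle_mean r (\<lambda>z. cmod (h z) powr p)" if "r \<in> {0..<1}" for r
    using that assms by (intro circle_mean_cong) auto
  then show ?thesis
    unfolding hardy_norm_def integral_mean_eq_circle_mean by simp
qed

lemma hardy_norm_cmult:
  assumes c: "0 < c" and f: "f holomorphic_on ball 0 1" and p: "0 < p"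
  shows "hardy_norm p (\<lambda>z. of_real c * f z) = ennreal c * hardy_norm p f"
proof -
  have m: "integral_mean p (\<lambda>z. of_real c * f z) r = c * integral_mean p f r" if r: "r \<in> {0..<1}" for r
  proof -
    let ?m = "circle_mean r (\<lambda>z. cmod (f z) powr p)"
    have "circle_mean r (\<lambda>z. cmod (of_real c * f z) powr p) = c powr p * ?m"
      using c by (simp add: norm_mult powr_mult)
    also have "\<dots> powr (1 / p) = (c powr p) powr (1 / p) * ?m powr (1 / p)"
      by (rule powr_mult)
    also have "(c powr p) powr (1 / p) = c" using c p by (simp add: powr_powr)
    finally show ?thesis by (simp only: integral_mean_eq_circle_mean)
  qed
  have "hardy_norm p (\<lambda>z. of_real c * f z) = (SUP r\<in>{0..<1}. ennreal c * ennreal (integral_mean p f r))"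
    unfolding hardy_norm_def using c by (intro SUP_cong refl) (simp add: m ennreal_mult')
  then show ?thesis by (simp only: hardy_norm_def SUP_mult_left_ennreal)
qed

section \<open>Norm estimates for the Volterra operator with symbol in BMOA\<close>

lemma BMOA_circle_mean_bound:
  assumes g: "g \<in> BMOA"
  obtains M where "0 < M" "\<And>a r. cmod a < 1 \<Longrightarrow> 0 < r \<Longrightarrow> r < 1 \<Longrightarrow>
      circle_mean r (\<lambda>z. (cmod (g (disk_involution a z) - g a))\<^sup>2) \<le> M"
proof -
  have gh: "g holomorphic_on ball 0 1" using g by (auto simp: BMOA_def hardy_space_def)
  let ?S = "SUP a\<in>ball 0 1. hardy_norm 2 (\<lambda>z. g (disk_involution a z) - g a)"
  have "?S < \<infinity>" using g by (auto simp: BMOA_def)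
  then obtain B where B: "0 \<le> B" "?S = ennreal B" by (cases ?S) auto
  show thesis
  \<comment> \<open>The added 1 keeps the bound positive, because the weight \<open>\<psi>\<close>
    is obtained by dividing by it.\<close>
  proof (rule that[of "B\<^sup>2 + 1"])
    fix a :: complex and r :: real assume a: "cmod a < 1" and r: "0 < r" "r < 1"
    have hol: "(\<lambda>z. g (disk_involution a z) - g a) holomorphic_on ball 0 1"
      using holomorphic_disk_involution_compose[OF gh a] by (intro holomorphic_intros)
    have "hardy_norm 2 (\<lambda>z. g (disk_involution a z) - g a) \<le> ?S"
      using a by (intro SUP_upper) auto
    then have "hardy_norm 2 (\<lambda>z. g (disk_involution a z) - g a) \<le> ennreal B" using B by simp
    from circle_mean_le_if_hardy_norm_le[OF hol _ this B(1), of r] r B(1)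
    show "circle_mean r (\<lambda>z. (cmod (g (disk_involution a z) - g a))\<^sup>2) \<le> B\<^sup>2 + 1" by simp
  qed (simp add: add_nonneg_pos)
qed

lemma volterra_monomial_tendsto_0:
  assumes p: "1 \<le> p" and g: "g \<in> BMOA" and \<eta>: "0 < \<eta>"
  shows "\<exists>N. \<forall>n\<ge>N. \<forall>r. 0 < r \<longrightarrow> r < 1 \<longrightarrow>
      circle_mean r (\<lambda>z. cmod (volterra g (\<lambda>z. z ^ n) z) powr p) \<le> \<eta>"
proof -
  have gh: "g holomorphic_on ball 0 1" and g2: "hardy_norm 2 g < \<infinity>"
    using g by (auto simp: BMOA_def hardy_space_def)
  obtain M where M: "0 < M" "\<And>a r. cmod a < 1 \<Longrightarrow> 0 < r \<Longrightarrow> r < 1 \<Longrightarrow>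
      circle_mean r (\<lambda>z. (cmod (g (disk_involution a z) - g a))\<^sup>2) \<le> M"
    using BMOA_circle_mean_bound[OF g] by blast
  have p2: "0 < 2 * p" "0 < p" using p by auto
  obtain C where C: "0 \<le> C"
    "\<And>f h r. f holomorphic_on ball 0 1 \<Longrightarrow>
       (\<And>z. cmod z < 1 \<Longrightarrow> (h has_field_derivative f z * deriv g z) (at z)) \<Longrightarrow> h 0 = 0 \<Longrightarrow> 0 < r \<Longrightarrow> r < 1 \<Longrightarrow>
       circle_mean r (\<lambda>z. cmod (h z) powr (2 * p)) \<le> C * circle_mean r (\<lambda>z. cmod (f z) powr (2 * p))"
    using volterra_circle_mean_estimate[OF p2(1) M(1) gh M(2)] by blast
  let ?h = "\<lambda>n. volterra g (\<lambda>z. z ^ n)"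
  have hol: "(\<lambda>z. z ^ n) holomorphic_on ball 0 1" for n :: nat by (intro holomorphic_intros)
  have hh: "?h n holomorphic_on ball 0 1" for n by (rule volterra_holomorphic[OF hol gh])
  have d: "(?h n has_field_derivative z ^ n * deriv g z) (at z)" if "cmod z < 1" for n z
    by (rule volterra_has_field_derivative[OF hol gh that])
  have large: "circle_mean r (\<lambda>z. cmod (?h n z) powr (2 * p)) \<le> C" if r: "0 < r" "r < 1" for r n
  proof -
    have "circle_mean r (\<lambda>z. cmod (?h n z) powr (2 * p)) \<le> C * circle_mean r (\<lambda>z. cmod (z ^ n) powr (2 * p))"
      by (rule C(2)[OF hol d _ r]) simp_all
    also have "circle_mean r (\<lambda>z. cmod (z ^ n) powr (2 * p)) \<le> circle_mean r (\<lambda>z. 1)"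
    proof (rule circle_mean_mono)
      show "cmod (\<zeta> ^ n) powr (2 * p) \<le> 1" if "cmod \<zeta> = r" for \<zeta>
        using that r p2 by (intro powr_le1) (auto simp: norm_power intro!: power_le_one)
    qed (use r continuous_on_circle_norm_powr[OF hol r(2) p2(1)] in auto)
    finally show ?thesis using C(1) by (simp add: mult_left_mono)
  qed
  define b where "b = (\<lambda>k. (deriv ^^ k) g 0 / fact k)"
  have bg: "disk_power_series b g"
    unfolding b_def by (rule holomorphic_imp_disk_power_series[OF gh])
  obtain B where B: "0 \<le> B" "hardy_norm 2 g = ennreal B"
    using g2 by (cases "hardy_norm 2 g") auto
  have "circle_mean r (\<lambda>\<zeta>. (cmod (g \<zeta>))\<^sup>2) \<le> B powr 2" if "0 < r" "r < 1" for r
    using circle_mean_le_if_hardy_norm_le[OF gh _ _ B(1), of 2 r] B(2) that by simp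
  then have sb: "summable (\<lambda>k. (cmod (b k))\<^sup>2)" by (rule summable_coeff_norm2[OF bg])
  define e where "e = (\<lambda>n. \<Sum>k. (cmod (b k))\<^sup>2 * (real k / real (k + n))\<^sup>2)"
  have e: "e \<longlonglongrightarrow> 0"
    unfolding e_def by (rule suminf_weighted_ratio_tendsto_0[OF sb]) simp
  have h2: "circle_mean r (\<lambda>z. (cmod (?h n z))\<^sup>2) \<le> e n" if "0 < r" "r < 1" for r n
    unfolding e_def by (rule volterra_monomial_norm2[OF bg d volterra_0 sb that])
  \<comment> \<open>Splits \<open>\<eta>\<close> into halves: \<open>\<delta> * (1 + C)\<close> is
    one of them, and the choice of \<open>N\<close> keeps \<open>A * e n\<close> below the
    other.\<close>
  define \<delta> where "\<delta> = \<eta> / (2 * (1 + C))"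
  have \<delta>: "0 < \<delta>" using \<eta> C(1) by (simp add: \<delta>_def)
  define A where "A = 1 / (\<delta> * \<delta> powr (2 / p))"
  have A: "0 < A" using \<delta> by (simp add: A_def)
  have "\<forall>\<^sub>F n in sequentially. e n < \<eta> / (2 * A)"
    using e \<eta> A by (intro order_tendstoD) auto
  then obtain N where N: "\<And>n. N \<le> n \<Longrightarrow> e n < \<eta> / (2 * A)"
    by (auto simp: eventually_sequentially)
  show ?thesis
  proof (intro exI[of _ N] allI impI)
    fix n r assume n: "N \<le> n" and r: "(0::real) < r" "r < 1"
    have "circle_mean r (\<lambda>z. cmod (?h n z) powr p) \<le> \<delta> * (1 + circle_mean r (\<lambda>z. cmod (?h n z) powr (2 * p)))
       + A * circle_mean r (\<lambda>z. (cmod (?h n z))\<^sup>2)"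
      unfolding A_def by (rule circle_mean_norm_powr_le_interpolation[OF hh r p2(2) \<delta>])
    also have "\<dots> \<le> \<delta> * (1 + C) + A * (\<eta> / (2 * A))"
      using large[OF r, of n] h2[OF r, of n] N[OF n] A \<delta>
      by (intro add_mono mult_left_mono) auto
    also have "\<dots> = \<eta>" using A C(1) by (simp add: \<delta>_def field_simps)
    finally show "circle_mean r (\<lambda>z. cmod (?h n z) powr p) \<le> \<eta>" .
  qed
qed

text \<open>A real bound \<open>B\<close> in place of the norm keeps the arithmetic out of the
  extended reals. The value 1 yields finiteness of the operator norm, the value 0 settles functions
  of norm zero.\<close>

lemma volterra_hardy_norm_le:
  assumes p: "1 \<le> p" and g: "g \<in> BMOA"
  obtains C where "0 \<le> C"
    "\<And>f B. f \<in> hardy_space p \<Longrightarrow> 0 \<le> B \<Longrightarrow> hardy_norm p f \<le> ennreal B \<Longrightarrow>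
       hardy_norm p (volterra g f) \<le> ennreal (C * B)"
proof -
  have gh: "g holomorphic_on ball 0 1" using g by (auto simp: BMOA_def hardy_space_def)
  obtain M where M: "0 < M" "\<And>a r. cmod a < 1 \<Longrightarrow> 0 < r \<Longrightarrow> r < 1 \<Longrightarrow>
      circle_mean r (\<lambda>z. (cmod (g (disk_involution a z) - g a))\<^sup>2) \<le> M"
    using BMOA_circle_mean_bound[OF g] by blast
  have p0: "0 < p" using p by auto
  obtain C where C: "0 \<le> C"
    "\<And>f h r. f holomorphic_on ball 0 1 \<Longrightarrow>
       (\<And>z. cmod z < 1 \<Longrightarrow> (h has_field_derivative f z * deriv g z) (at z)) \<Longrightarrow> h 0 = 0 \<Longrightarrow> 0 < r \<Longrightarrow> r < 1 \<Longrightarrow>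
       circle_mean r (\<lambda>z. cmod (h z) powr p) \<le> C * circle_mean r (\<lambda>z. cmod (f z) powr p)"
    using volterra_circle_mean_estimate[OF p0 M(1) gh M(2)] by blast
  show thesis
  proof (rule that[of "C powr (1 / p)"])
    fix f B assume f: "f \<in> hardy_space p" and B: "0 \<le> B" "hardy_norm p f \<le> ennreal B"
    have fh: "f holomorphic_on ball 0 1" using f by (simp add: hardy_space_def)
    have "hardy_norm p (volterra g f) \<le> ennreal ((C * B powr p) powr (1 / p))"
    proof (rule hardy_norm_le[OF volterra_holomorphic[OF fh gh] p0 _ volterra_0])
      fix r :: real assume r: "0 < r" "r < 1"
      have "circle_mean r (\<lambda>z. cmod (volterra g f z) powr p) \<le> C * circle_mean r (\<lambda>z. cmod (f z) powr p)"
        by (rule C(2)[OF fh volterra_has_field_derivative[OF fh gh] volterra_0 r])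
      also have "\<dots> \<le> C * B powr p"
        using C(1) r circle_mean_le_if_hardy_norm_le[OF fh p0 B(2,1), of r] by (intro mult_left_mono) auto
      finally show "circle_mean r (\<lambda>z. cmod (volterra g f z) powr p) \<le> C * B powr p" .
    qed
    also have "(C * B powr p) powr (1 / p) = C powr (1 / p) * B"
      using C(1) B(1) p0 by (simp add: powr_mult powr_powr)
    finally show "hardy_norm p (volterra g f) \<le> ennreal (C powr (1 / p) * B)" .
  qed simp
qed

lemma volterra_cmult:
  assumes f: "f holomorphic_on ball 0 1" and g: "g holomorphic_on ball 0 1" and z: "cmod z < 1"
  shows "volterra g (\<lambda>z. c * f z) z = c * volterra g f z"
proof (rule eq_on_disk_if_derivative_eq[OF _ _ _ z])
  fix w :: complex assume w: "cmod w < 1"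
  have cf: "(\<lambda>z. c * f z) holomorphic_on ball 0 1" using f by (intro holomorphic_intros)
  show "(volterra g (\<lambda>z. c * f z) has_field_derivative (c * f w) * deriv g w) (at w)"
    by (rule volterra_has_field_derivative[OF cf g w])
  show "((\<lambda>z. c * volterra g f z) has_field_derivative (c * f w) * deriv g w) (at w)"
    using DERIV_cmult[OF volterra_has_field_derivative[OF f g w], of c] by (simp add: mult.assoc)
qed simp

theorem theorem2p2:
  fixes p :: real and g :: "complex \<Rightarrow> complex"
  assumes "1 \<le> p"
    and "g \<in> BMOA"
    and "\<not> g constant_on ball 0 1"
  shows "hardy_space p \<subset> optimal_domain p g \<and>
    hardy_operator_norm p (volterra g) < \<infinity> \<and>
    (\<forall>f\<in>hardy_space p.
       optimal_domain_norm p g f \<le> hardy_operator_norm p (volterra g) * hardy_norm p f)"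
proof -
  have p0: "0 < p" using assms(1) by simp
  have gh: "g holomorphic_on ball 0 1" using assms(2) by (auto simp: BMOA_def hardy_space_def)
  obtain C where C: "0 \<le> C"
    "\<And>f B. f \<in> hardy_space p \<Longrightarrow> 0 \<le> B \<Longrightarrow> hardy_norm p f \<le> ennreal B \<Longrightarrow>
       hardy_norm p (volterra g f) \<le> ennreal (C * B)"
    using volterra_hardy_norm_le[OF assms(1,2)] by blast
  have finite: "\<exists>B\<ge>0. hardy_norm p f = ennreal B" if "f \<in> hardy_space p" for f
    using that by (cases "hardy_norm p f") (auto simp: hardy_space_def)
  have sub: "hardy_space p \<subseteq> optimal_domain p g"
  proof
    fix f assume f: "f \<in> hardy_space p"
    then have fh: "f holomorphic_on ball 0 1" by (simp add: hardy_space_def)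
    obtain B where "0 \<le> B" "hardy_norm p f = ennreal B" using finite[OF f] by blast
    then have "hardy_norm p (volterra g f) < \<infinity>"
      using C(2)[OF f, of B] by (simp add: le_less_trans[OF _ ennreal_less_top])
    then show "f \<in> optimal_domain p g"
      using fh volterra_holomorphic[OF fh gh] by (simp add: optimal_domain_def hardy_space_def)
  qed
  obtain a f where af: "disk_power_series a f" "\<And>A. \<exists>m. A < cmod (a m)"
    "\<And>r. 0 < r \<Longrightarrow> r < 1 \<Longrightarrow> circle_mean r (\<lambda>z. cmod (volterra g f z) powr p) \<le> 2 * 2 powr p"
    using exists_unbounded_coeffs_volterra_bounded[OF assms(1) gh volterra_monomial_tendsto_0[OF assms(1,2)]] by blast
  have fh: "f holomorphic_on ball 0 1" using disk_power_series.holomorphic[OF af(1)] .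
  have "f \<in> optimal_domain p g"
    using fh volterra_holomorphic[OF fh gh]
      hardy_norm_le[OF volterra_holomorphic[OF fh gh] p0 af(3) volterra_0]
    by (simp add: optimal_domain_def hardy_space_def le_less_trans[OF _ ennreal_less_top])
  moreover have "f \<notin> hardy_space p"
  proof
    assume "f \<in> hardy_space p"
    then obtain B where B: "0 \<le> B" "hardy_norm p f = ennreal B" using finite by blast
    have "cmod (a m) \<le> 1 + B powr p" for m
      by (rule coeff_bounded[OF af(1) assms(1)])
         (use circle_mean_le_if_hardy_norm_le[OF fh p0 _ B(1)] B(2) in simp)
    then show False using af(2)[of "1 + B powr p"] by (auto simp: not_less[symmetric])
  qed
  ultimately have strict: "hardy_space p \<subset> optimal_domain p g" using sub by blast
  let ?T = "hardy_operator_norm p (volterra g)"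
  have "?T \<le> ennreal C"
    unfolding hardy_operator_norm_def using C(2)[of _ 1] by (intro SUP_least) auto
  then have T: "?T < \<infinity>" by (simp add: le_less_trans[OF _ ennreal_less_top])
  have "hardy_norm p (volterra g f) \<le> ?T * hardy_norm p f" if f: "f \<in> hardy_space p" for f
  proof -
    have fh: "f holomorphic_on ball 0 1" using f by (simp add: hardy_space_def)
    obtain B where B: "0 \<le> B" "hardy_norm p f = ennreal B" using finite[OF f] by blast
    show ?thesis
    \<comment> \<open>The operator norm is a supremum over the unit ball, so \<open>f\<close> has to
      be scaled to norm 1. Norm zero forbids this, but then the bound \<open>C * 0\<close> already
      makes the image have norm zero.\<close>
    proof (cases "B = 0")
      case True
      then show ?thesis using C(2)[OF f B(1)] B(2) by simp
    next
      case False
      then have B0: "0 < 1 / B" using B(1) by simp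
      let ?f = "\<lambda>z. of_real (1 / B) * f z"
      have "hardy_norm p ?f = ennreal (1 / B) * ennreal B"
        using hardy_norm_cmult[OF B0 fh p0] B(2) by simp
      also have "\<dots> = 1" using B(1) False by (simp flip: ennreal_mult)
      finally have "hardy_norm p ?f = 1" .
      moreover have "?f holomorphic_on ball 0 1" using fh by (intro holomorphic_intros)
      ultimately have "hardy_norm p (volterra g ?f) \<le> ?T"
        unfolding hardy_operator_norm_def by (intro SUP_upper) (simp add: hardy_space_def)
      moreover have "hardy_norm p (volterra g ?f) = hardy_norm p (\<lambda>z. of_real (1 / B) * volterra g f z)"
        by (rule hardy_norm_cong) (rule volterra_cmult[OF fh gh])
      ultimately have "ennreal (1 / B) * hardy_norm p (volterra g f) \<le> ?T"
        using hardy_norm_cmult[OF B0 volterra_holomorphic[OF fh gh] p0] by simp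
      then have "ennreal B * (ennreal (1 / B) * hardy_norm p (volterra g f)) \<le> ennreal B * ?T"
        by (rule mult_left_mono) simp
      moreover have "ennreal B * ennreal (1 / B) = 1" using B(1) False by (simp flip: ennreal_mult)
      ultimately show ?thesis by (simp add: B(2) mult.commute flip: mult.assoc)
    qed
  qed
  then show ?thesis using strict T by (simp add: optimal_domain_norm_def)
qed

end
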